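(* Let $\xi$ be a standard normal random variable. There exists a universal constant $C > 0$ such that $$\limsup_{n \rightarrow \infty} K\left(\xi,\sum_{k=1}^n \xi_{n,k}\right) \leq C\, \mathrm{Lin}\left(\{\xi_{n,k}\}\right)$$ for all standard triangular arrays $\{\xi_{n,k}\}$, where $K$ is the Kolmogorov distance and $\mathrm{Lin}$ is the Lindeberg index.
   Context: All random variables are real-valued and defined on a fixed probability space $(\Omega,\mathcal{F},\mathbb{P})$. A standard triangular array (STA) is a family $\{\xi_{n,k}\}_{n \geq 1,\, 1 \leq k \leq n}$ of random variables such that $\xi_{n,1},\ldots,\xi_{n,n}$ are independent for all $n$, $\mathbb{E}[\xi_{n,k}] = 0$ for all $n,k$, and $\sum_{k=1}^n \mathbb{E}[\xi_{n,k}^2] = 1$ for all $n$. For a random variable $X$ and an event $A$, $\mathbb{E}[X ; A]$ denotes $\mathbb{E}[X \mathbf{1}_A]$. The Lindeberg index of an STA is $$\mathrm{Lin}\left(\{\xi_{n,k}\}\right) = \sup_{\epsilon > 0} \limsup_{n \rightarrow \infty} \sum_{k=1}^n \mathbb{E}\left[\xi_{n,k}^2 ; \left|\xi_{n,k}\right| > \epsilon\right].$$ The Kolmogorov distance between random variables $\eta,\eta'$ is $K(\eta,\eta') = \sup_{x \in \mathbb{R}} \left|\mathbb{P}[\eta \leq x] - \mathbb{P}[\eta' \leq x]\right|$. The constant $C$ being universal means that it does not depend on the array. *)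

theory Defs
  imports "HOL-Probability.Probability"
begin

text \<open>Only the entries \<open>\<xi> n k\<close> with \<open>1 \<le> k \<le> n\<close> belong to the array. Integrability is listed
  explicitly because the Bochner integral of a non-integrable function is \<open>0\<close>; measurability is
  part of \<open>prob_space.indep_vars\<close>.\<close>

definition standard_triangular_array ::
    "'a measure \<Rightarrow> (nat \<Rightarrow> nat \<Rightarrow> 'a \<Rightarrow> real) \<Rightarrow> bool" where
  "standard_triangular_array M \<xi> \<longleftrightarrow>
     (\<forall>n\<ge>1.
        prob_space.indep_vars M (\<lambda>_. borel) (\<xi> n) {1..n} \<and>
        (\<forall>k\<in>{1..n}.
           integrable M (\<xi> n k) \<and>
           integrable M (\<lambda>\<omega>. (\<xi> n k \<omega>)\<^sup>2) \<and>
           integral\<^sup>L M (\<xi> n k) = 0) \<and>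
        (\<Sum>k=1..n. \<integral>\<omega>. (\<xi> n k \<omega>)\<^sup>2 \<partial>M) = 1)"

text \<open>The suprema and upper limits are taken in \<^typ>\<open>ereal\<close>, where they always exist.\<close>

definition Lindeberg_index ::
    "'a measure \<Rightarrow> (nat \<Rightarrow> nat \<Rightarrow> 'a \<Rightarrow> real) \<Rightarrow> ereal" where
  "Lindeberg_index M \<xi> =
     (SUP \<epsilon>\<in>{0::real<..}. limsup (\<lambda>n. ereal
        (\<Sum>k=1..n. LINT \<omega>:{\<omega> \<in> space M. \<bar>\<xi> n k \<omega>\<bar> > \<epsilon>}|M. (\<xi> n k \<omega>)\<^sup>2)))"

definition Kolmogorov_dist ::
    "'a measure \<Rightarrow> ('a \<Rightarrow> real) \<Rightarrow> ('a \<Rightarrow> real) \<Rightarrow> ereal" where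
  "Kolmogorov_dist M \<eta> \<eta>' =
     (SUP x::real. ereal \<bar>\<P>(\<omega> in M. \<eta> \<omega> \<le> x) - \<P>(\<omega> in M. \<eta>' \<omega> \<le> x)\<bar>)"

end

theory Submission
  imports Defs
begin

text \<open>Stein's method in the form of Chen and Shao. Put \<open>\<beta> = \<Sum>\<^sub>k E (\<xi>\<^sub>k\<^sup>2 min \<bar>\<xi>\<^sub>k\<bar> 1)\<close>. The bounded solution \<open>f\<close>
  of \<open>f'(w) - w f(w) = 1(w \<le> z) - \<Phi>(z)\<close> has increments controlled by the step size except near
  \<open>z\<close>, and a concentration inequality says that each leave-one-out sum falls into an interval of length
  \<open>m\<close> with probability \<open>O(m + \<beta>)\<close>. Hence the Kolmogorov distance is \<open>O(\<beta>)\<close> without any truncation.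
  Finally \<open>\<beta> \<le> \<epsilon> + \<Sum>\<^sub>k E (\<xi>\<^sub>k\<^sup>2; \<bar>\<xi>\<^sub>k\<bar> > \<epsilon>)\<close> for every \<open>\<epsilon> \<le> 1\<close>.\<close>

subsection \<open>Mills ratio and the solution of the Stein equation\<close>

text \<open>The obstacle is the unit jump of f' at z, which spoils a second order expansion of f
  whenever z separates the leave-one-out sum W from the full sum S = W + X. Such a crossing puts W
  into the band of half-width \<bar>X\<bar> around z. Since W is independent of X, that width can be
  frozen, and only then does a concentration bound for fixed intervals apply. Capping increments at
  1 makes min \<bar>X\<bar> 1 appear where the classical argument has a third moment, so finite
  variances suffice. The increment bound is spent twice per summand: on E (X f(S)) against E (X^2) E
  (f'(W)), and on f'(W) against f'(S). Each use costs 28 times the truncated third moment plus 16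
  \<delta> times the variance, where \<delta> is any bound for \<beta>; summing gives 56 \<beta> +
  32 \<delta> \<le> 88 \<delta>. The argument needs \<delta> \<le> 1/64, and for larger \<delta> the
  bound exceeds 1 and is trivial.\<close>

lemma std_normal_density_DERIV:
  "(std_normal_density has_real_derivative - x * std_normal_density x) (at x)"
  unfolding normal_density_def
  by (auto intro!: derivative_eq_intros simp: field_simps power2_eq_square)

lemma continuous_on_std_normal_density: "continuous_on S std_normal_density"
  using DERIV_isCont[OF std_normal_density_DERIV]
  by (intro continuous_at_imp_continuous_on) blast

lemma std_normal_density_minus: "std_normal_density (- x) = std_normal_density x"
  by (simp add: normal_density_def)

text \<open>Serves to bound the Mills ratio near 0, where \<open>mult_mills_le_1\<close> gives
  nothing. The value 1/8 is 1/4, from sqrt (2 pi) \<le> 4, times 1/2, from exp t \<ge> 1 +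
  t.\<close>

lemma std_normal_density_ge:
  assumes "0 \<le> x" "x \<le> 1"
  shows "1 / 8 \<le> std_normal_density x"
proof -
  have "sqrt (2 * pi) \<le> sqrt 16"
    using pi_less_4 by (intro real_sqrt_le_mono) auto
  then have s: "1 / 4 \<le> 1 / sqrt (2 * pi)"
    by (simp add: field_simps)
  have "x\<^sup>2 \<le> 1" using assms by (simp add: power_le_one)
  moreover have "1 + (- (x\<^sup>2) / 2) \<le> exp (- (x\<^sup>2) / 2)" by (rule exp_ge_add_one_self)
  ultimately have "1 / 2 \<le> exp (- (x\<^sup>2) / 2)" by linarith
  from mult_mono[OF s this] show ?thesis by (simp add: normal_density_def)
qed

section \<open>The standard normal distribution function\<close>

abbreviation normal_cdf :: "real \<Rightarrow> real" where
  "normal_cdf \<equiv> cdf std_normal_distribution"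

lemma normal_cdf_diff:
  assumes "x < y"
  shows "normal_cdf y - normal_cdf x = integral {x..y} std_normal_density"
proof -
  interpret real_distribution std_normal_distribution by (rule real_dist_normal_dist)
  have [simp]: "set_integrable lborel {x..y} std_normal_density"
    by (rule borel_integrable_atLeastAtMost') (rule continuous_on_std_normal_density)
  have "normal_cdf y - normal_cdf x = measure std_normal_distribution {x<..y}"
    using assms by (rule cdf_diff_eq)
  also have "\<dots> = (\<integral>t. indicator {x<..y} t \<partial>std_normal_distribution)"
    by simp
  also have "\<dots> = (\<integral>t. std_normal_density t * indicator {x<..y} t \<partial>lborel)"
    by (rule integral_real_density) (auto intro!: AE_I2)
  also have "\<dots> = (LINT t:{x..y}|lborel. std_normal_density t)"
    unfolding set_lebesgue_integral_def
  proof (rule integral_cong_AE)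
    show "AE t in lborel. std_normal_density t * indicator {x<..y} t
        = indicator {x..y} t *\<^sub>R std_normal_density t"
      using AE_lborel_singleton[of x] by eventually_elim (auto simp: indicator_def)
  qed auto
  also have "\<dots> = integral {x..y} std_normal_density"
    by (intro set_borel_integral_eq_integral) simp
  finally show ?thesis .
qed

lemma normal_cdf_DERIV: "(normal_cdf has_real_derivative std_normal_density x) (at x)"
proof -
  \<comment> \<open>The base point only has to lie strictly left of x, so that
    \<open>normal_cdf_diff\<close> is available on a whole neighbourhood of x.\<close>
  have "((\<lambda>u. integral {x-1..u} std_normal_density) has_real_derivative std_normal_density x)
      (at x within {x-1..x+1})"
    by (rule integral_has_real_derivative[OF continuous_on_std_normal_density]) auto
  then have "((\<lambda>u. integral {x-1..u} std_normal_density) has_real_derivative std_normal_density x) (at x)"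
    by (simp add: at_within_Icc_at)
  from DERIV_add[OF DERIV_const[of "normal_cdf (x - 1)"] this]
  have *: "((\<lambda>u. normal_cdf (x - 1) + integral {x-1..u} std_normal_density)
      has_real_derivative std_normal_density x) (at x)"
    by simp
  have "\<forall>\<^sub>F u in nhds x. u \<in> {x-1<..}"
    by (rule eventually_nhds_in_open) auto
  then have ev: "\<forall>\<^sub>F u in nhds x.
      normal_cdf (x - 1) + integral {x-1..u} std_normal_density = normal_cdf u"
  proof (rule eventually_mono)
    fix u assume "u \<in> {x-1<..}"
    then show "normal_cdf (x - 1) + integral {x-1..u} std_normal_density = normal_cdf u"
      using normal_cdf_diff[of "x - 1" u] by simp
  qed
  show ?thesis
    by (rule DERIV_cong_ev[OF refl ev refl, THEN iffD1, OF *])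
qed

lemma normal_cdf_bounds: "0 \<le> normal_cdf x" "normal_cdf x \<le> 1"
proof -
  interpret real_distribution std_normal_distribution by (rule real_dist_normal_dist)
  show "0 \<le> normal_cdf x" "normal_cdf x \<le> 1" by (auto simp: cdf_nonneg cdf_bounded_prob)
qed

lemma normal_cdf_mono: "x \<le> y \<Longrightarrow> normal_cdf x \<le> normal_cdf y"
proof -
  interpret real_distribution std_normal_distribution by (rule real_dist_normal_dist)
  show "x \<le> y \<Longrightarrow> ?thesis" by (rule cdf_nondecreasing)
qed

lemma normal_cdf_at_top: "(normal_cdf \<longlongrightarrow> 1) at_top"
proof -
  interpret real_distribution std_normal_distribution by (rule real_dist_normal_dist)
  show ?thesis by (rule cdf_lim_at_top_prob)
qed

lemma normal_cdf_at_bot: "(normal_cdf \<longlongrightarrow> 0) at_bot"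
proof -
  interpret real_distribution std_normal_distribution by (rule real_dist_normal_dist)
  show ?thesis by (rule cdf_lim_at_bot)
qed

text \<open>The density is even, so \<open>normal_cdf u + normal_cdf (- u)\<close> has derivative 0;
  its limit at infinity identifies the constant as 1.\<close>

lemma normal_cdf_minus: "normal_cdf (- x) = 1 - normal_cdf x"
proof -
  have "((\<lambda>u. normal_cdf u + normal_cdf (- u)) has_real_derivative 0) (at u)" for u
    using DERIV_add[OF normal_cdf_DERIV
        DERIV_chain2[OF normal_cdf_DERIV DERIV_minus[OF DERIV_ident]], of u]
    by (simp add: std_normal_density_minus)
  then have const: "normal_cdf u + normal_cdf (- u) = normal_cdf x + normal_cdf (- x)" for u
    using DERIV_isconst_all[of "\<lambda>u. normal_cdf u + normal_cdf (- u)" u x] by blast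
  have "((\<lambda>u. normal_cdf u + normal_cdf (- u)) \<longlongrightarrow> 1 + 0) at_top"
    by (rule tendsto_add[OF normal_cdf_at_top
        filterlim_compose[OF normal_cdf_at_bot filterlim_uminus_at_bot_at_top]])
  moreover have "(\<lambda>u. normal_cdf u + normal_cdf (- u)) = (\<lambda>_. normal_cdf x + normal_cdf (- x))"
    using const by (rule ext)
  ultimately have "((\<lambda>u::real. normal_cdf x + normal_cdf (- x)) \<longlongrightarrow> 1) at_top"
    by simp
  then show ?thesis by (simp add: tendsto_const_iff)
qed

text \<open>The difference \<open>std_normal_density u / u - (1 - normal_cdf u)\<close> has
  derivative \<open>- std_normal_density u / u\<^sup>2\<close>, so it decreases; since it tends to
  0, it is nonnegative.\<close>

lemma mills_bound:
  assumes "0 < x"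
  shows "x * (1 - normal_cdf x) \<le> std_normal_density x"
proof -
  let ?G = "\<lambda>u. std_normal_density u / u - (1 - normal_cdf u)"
  have d: "\<exists>y. (?G has_real_derivative y) (at u) \<and> y \<le> 0" if "x \<le> u" for u
  proof (intro exI conjI)
    have "u > 0" using that assms by simp
    then show "(?G has_real_derivative - std_normal_density u / u\<^sup>2) (at u)"
      using DERIV_diff[OF DERIV_divide[OF std_normal_density_DERIV DERIV_ident]
          DERIV_diff[OF DERIV_const normal_cdf_DERIV], of u 1]
      by (simp add: diff_divide_distrib power2_eq_square)
  qed auto
  have mono: "?G u \<le> ?G x" if "x \<le> u" for u
    by (rule DERIV_nonpos_imp_nonincreasing[OF that]) (use d in auto)
  have "((\<lambda>u. std_normal_density u / u) \<longlongrightarrow> 0) at_top"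
  proof (rule Lim_null_comparison)
    show "\<forall>\<^sub>F u in at_top. norm (std_normal_density u / u) \<le> inverse u"
      using eventually_gt_at_top[of 0]
    proof eventually_elim
      case (elim u)
      have "exp (- (u\<^sup>2) / 2) \<le> 1" by simp
      moreover have "1 \<le> sqrt (2 * pi)" using pi_gt3 by simp
      ultimately have "exp (- (u\<^sup>2) / 2) \<le> sqrt (2 * pi)" by linarith
      then have "std_normal_density u \<le> 1"
        by (simp add: normal_density_def)
      then show ?case using elim by (simp add: field_simps)
    qed
    show "(inverse \<longlongrightarrow> (0::real)) at_top" by (rule tendsto_inverse_0_at_top) (rule filterlim_ident)
  qed
  then have "(?G \<longlongrightarrow> 0 - (1 - 1)) at_top"
    by (rule tendsto_diff[OF _ tendsto_diff[OF tendsto_const normal_cdf_at_top]])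
  then have "0 \<le> ?G x"
    using mono
    by (intro tendsto_upperbound[of ?G 0 at_top])
      (auto simp: eventually_at_top_linorder simp del: diff_le_eq intro!: exI[of _ x])
  then show ?thesis using assms by (simp add: field_simps)
qed

section \<open>The Mills ratio\<close>

definition mills :: "real \<Rightarrow> real" where
  "mills x = (1 - normal_cdf x) / std_normal_density x"

lemma mills_nonneg: "0 \<le> mills x"
  by (simp add: mills_def normal_cdf_bounds)

lemma mult_mills_le_1: "0 \<le> x \<Longrightarrow> x * mills x \<le> 1"
  using mills_bound[of x] normal_density_pos[of 1 0 x]
  by (cases "x = 0") (auto simp: mills_def field_simps)

lemma mills_le:
  assumes "0 \<le> x"
  shows "mills x \<le> 8"
proof (cases "x \<le> 1")
  case True
  have "1 - normal_cdf x \<le> 8 * std_normal_density x"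
    using std_normal_density_ge[of x] True assms normal_cdf_bounds(1)[of x] by linarith
  then show ?thesis using normal_density_pos[of 1 0 x] by (simp add: mills_def field_simps)
next
  case False
  have "1 * mills x \<le> x * mills x"
    using False mills_nonneg by (intro mult_right_mono) auto
  then show ?thesis using mult_mills_le_1[of x] assms by simp
qed

text \<open>The ratio alone is unbounded towards minus infinity, but its product with
  \<open>normal_cdf\<close> is an even function, so both estimates reduce to the half line where the
  ratio is controlled.\<close>

lemma mills_mult_cdf_le: "mills x * normal_cdf x \<le> 8"
  and abs_mills_mult_cdf_le: "\<bar>x\<bar> * (mills x * normal_cdf x) \<le> 1"
proof -
  have sym: "mills x * normal_cdf x = mills (- x) * normal_cdf (- x)"
    by (simp add: mills_def normal_cdf_minus std_normal_density_minus)
  have *: "mills x * normal_cdf x \<le> mills \<bar>x\<bar>"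
  proof (cases "0 \<le> x")
    case True
    then show ?thesis using mult_left_mono[OF normal_cdf_bounds(2) mills_nonneg, of x x] by simp
  next
    case False
    then show ?thesis unfolding sym
      using mult_left_mono[OF normal_cdf_bounds(2) mills_nonneg, of "-x" "-x"] by simp
  qed
  show "mills x * normal_cdf x \<le> 8" using * mills_le[of "\<bar>x\<bar>"] by simp
  show "\<bar>x\<bar> * (mills x * normal_cdf x) \<le> 1"
    using mult_left_mono[OF *, of "\<bar>x\<bar>"] mult_mills_le_1[of "\<bar>x\<bar>"] by simp
qed

lemma mills_DERIV: "(mills has_real_derivative x * mills x - 1) (at x)"
proof -
  let ?d = "std_normal_density x"
  have "?d \<noteq> 0" using normal_density_pos[of 1 0 x] by simp
  have "((\<lambda>x. (1 - normal_cdf x) / std_normal_density x) has_real_derivative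
      ((0 - ?d) * ?d - (1 - normal_cdf x) * (- x * ?d)) / (?d * ?d)) (at x)"
    by (intro DERIV_divide DERIV_diff DERIV_const normal_cdf_DERIV std_normal_density_DERIV) fact
  also have "((0 - ?d) * ?d - (1 - normal_cdf x) * (- x * ?d)) / (?d * ?d) = x * mills x - 1"
    using \<open>?d \<noteq> 0\<close> by (simp add: mills_def field_simps)
  finally show ?thesis by (simp add: mills_def[abs_def])
qed

lemma borel_measurable_mills [measurable]: "mills \<in> borel_measurable borel"
  using DERIV_isCont[OF mills_DERIV]
  by (intro borel_measurable_continuous_onI continuous_at_imp_continuous_on) blast

section \<open>The Stein solution on one side of its break\<close>

definition stein_branch :: "real \<Rightarrow> real \<Rightarrow> real" where
  "stein_branch z w = mills w * normal_cdf z"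

text \<open>This is the Stein equation solved for the derivative at points beyond z, where the
  indicator is 0.\<close>

definition stein_branch_deriv :: "real \<Rightarrow> real \<Rightarrow> real" where
  "stein_branch_deriv z w = w * stein_branch z w - normal_cdf z"

lemma stein_branch_DERIV:
  "(stein_branch z has_real_derivative stein_branch_deriv z w) (at w)"
  unfolding stein_branch_def stein_branch_deriv_def
  by (auto intro!: derivative_eq_intros mills_DERIV simp: algebra_simps)

text \<open>For \<open>z \<le> w\<close> monotonicity replaces \<open>normal_cdf z\<close> by
  \<open>normal_cdf w\<close>. This removes z from the estimates and makes every constant uniform in
  z.\<close>

lemma stein_branch_bounds:
  assumes "z \<le> w"
  shows "0 \<le> stein_branch z w" "stein_branch z w \<le> 8" "\<bar>w * stein_branch z w\<bar> \<le> 1"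
    "\<bar>stein_branch_deriv z w\<bar> \<le> 2"
proof -
  show 0: "0 \<le> stein_branch z w"
    by (simp add: stein_branch_def mills_nonneg normal_cdf_bounds)
  have le: "stein_branch z w \<le> mills w * normal_cdf w"
    unfolding stein_branch_def by (intro mult_left_mono normal_cdf_mono assms mills_nonneg)
  show "stein_branch z w \<le> 8" using le mills_mult_cdf_le[of w] by simp
  show 1: "\<bar>w * stein_branch z w\<bar> \<le> 1"
    using mult_left_mono[OF le, of "\<bar>w\<bar>"] abs_mills_mult_cdf_le[of w] 0 by (simp add: abs_mult)
  show "\<bar>stein_branch_deriv z w\<bar> \<le> 2"
    using 1 normal_cdf_bounds[of z] by (simp add: stein_branch_deriv_def)
qed

lemma stein_branch_lipschitz:
  assumes "z \<le> u" "z \<le> v"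
  shows "\<bar>stein_branch z u - stein_branch z v\<bar> \<le> 2 * \<bar>u - v\<bar>"
proof -
  have "norm (stein_branch z u - stein_branch z v) \<le> 2 * norm (u - v)"
  proof (rule field_differentiable_bound[of "{z..}" _ "stein_branch_deriv z"])
    fix w assume "w \<in> {z..}"
    show "(stein_branch z has_field_derivative stein_branch_deriv z w) (at w within {z..})"
      by (rule has_field_derivative_at_within) (rule stein_branch_DERIV)
    show "norm (stein_branch_deriv z w) \<le> 2"
      using stein_branch_bounds(4) \<open>w \<in> {z..}\<close> by simp
  qed (use assms in auto)
  then show ?thesis by simp
qed

text \<open>The second derivative is \<open>stein_branch z w + w * stein_branch_deriv z w\<close>,
  at most 8 + 2 \<bar>w\<bar>, and \<bar>w\<bar> \<le> 1 + \<bar>u\<bar> on the unit ball around u.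
  The weight 1 + \<bar>u\<bar> is harmless later, when u is a random sum whose mean absolute value
  is at most 1.\<close>

lemma stein_branch_deriv_lipschitz:
  assumes "z \<le> u" "z \<le> v" "\<bar>v - u\<bar> \<le> 1"
  shows "\<bar>stein_branch_deriv z v - stein_branch_deriv z u\<bar> \<le> 10 * \<bar>v - u\<bar> * (1 + \<bar>u\<bar>)"
proof -
  let ?S = "{z..} \<inter> cball u 1"
  have "norm (stein_branch_deriv z v - stein_branch_deriv z u) \<le> (10 * (1 + \<bar>u\<bar>)) * norm (v - u)"
  proof (rule field_differentiable_bound[of ?S _ "\<lambda>w. stein_branch z w + w * stein_branch_deriv z w"])
    show "convex ?S" by (intro convex_Int) auto
    fix w assume w: "w \<in> ?S"
    show "(stein_branch_deriv z has_field_derivative stein_branch z w + w * stein_branch_deriv z w)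
        (at w within ?S)"
    proof (rule has_field_derivative_at_within)
      have "((\<lambda>w. w * stein_branch z w - normal_cdf z) has_real_derivative
          1 * stein_branch z w + stein_branch_deriv z w * w - 0) (at w)"
        by (intro DERIV_diff DERIV_mult DERIV_ident DERIV_const stein_branch_DERIV)
      then show "(stein_branch_deriv z has_real_derivative
          stein_branch z w + w * stein_branch_deriv z w) (at w)"
        by (simp add: stein_branch_deriv_def[abs_def] mult.commute)
    qed
    have "z \<le> w" "\<bar>w\<bar> \<le> 1 + \<bar>u\<bar>" using w by (auto simp: dist_real_def)
    have "\<bar>w\<bar> * \<bar>stein_branch_deriv z w\<bar> \<le> (1 + \<bar>u\<bar>) * 2"
      using stein_branch_bounds(4)[OF \<open>z \<le> w\<close>] \<open>\<bar>w\<bar> \<le> 1 + \<bar>u\<bar>\<close> by (intro mult_mono) auto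
    then show "norm (stein_branch z w + w * stein_branch_deriv z w) \<le> 10 * (1 + \<bar>u\<bar>)"
      using stein_branch_bounds(1,2)[OF \<open>z \<le> w\<close>]
        abs_triangle_ineq[of "stein_branch z w" "w * stein_branch_deriv z w"]
      by (simp add: abs_mult)
  qed (use assms in \<open>auto simp: dist_real_def abs_minus_commute\<close>)
  then show ?thesis by (simp add: mult_ac)
qed

lemma stein_branch_taylor:
  assumes "z \<le> u" "z \<le> v" "\<bar>v - u\<bar> \<le> 1"
  shows "\<bar>stein_branch z v - stein_branch z u - (v - u) * stein_branch_deriv z u\<bar>
    \<le> \<bar>v - u\<bar> * (10 * \<bar>v - u\<bar> * (1 + \<bar>u\<bar>))"
proof -
  let ?S = "closed_segment u v"
  let ?h = "\<lambda>w. stein_branch z w - w * stein_branch_deriv z u"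
  have "norm (?h v - ?h u) \<le> (10 * \<bar>v - u\<bar> * (1 + \<bar>u\<bar>)) * norm (v - u)"
  proof (rule field_differentiable_bound[of ?S _ "\<lambda>w. stein_branch_deriv z w - stein_branch_deriv z u"])
    fix w assume w: "w \<in> ?S"
    show "(?h has_field_derivative stein_branch_deriv z w - stein_branch_deriv z u) (at w within ?S)"
    proof (rule has_field_derivative_at_within)
      show "(?h has_real_derivative stein_branch_deriv z w - stein_branch_deriv z u) (at w)"
        using DERIV_diff[OF stein_branch_DERIV DERIV_cmult_right[OF DERIV_ident]] by simp
    qed
    have *: "z \<le> w" "\<bar>w - u\<bar> \<le> \<bar>v - u\<bar>"
      using w assms by (auto simp: closed_segment_eq_real_ivl split: if_splits)
    then have "\<bar>stein_branch_deriv z w - stein_branch_deriv z u\<bar> \<le> 10 * \<bar>w - u\<bar> * (1 + \<bar>u\<bar>)"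
      using assms by (intro stein_branch_deriv_lipschitz) auto
    also have "\<dots> \<le> 10 * \<bar>v - u\<bar> * (1 + \<bar>u\<bar>)"
      using * by (intro mult_right_mono) auto
    finally show "norm (stein_branch_deriv z w - stein_branch_deriv z u) \<le> 10 * \<bar>v - u\<bar> * (1 + \<bar>u\<bar>)"
      by simp
  qed auto
  then show ?thesis by (simp add: algebra_simps)
qed

text \<open>Negating both arguments of the right branch gives
  \<open>normal_cdf w * (1 - normal_cdf z) / std_normal_density w\<close>, the classical solution
  left of z. Each estimate for \<open>stein_branch\<close> thus serves both sides.\<close>

definition stein_sol :: "real \<Rightarrow> real \<Rightarrow> real" where
  "stein_sol z w = (if w \<le> z then stein_branch (- z) (- w) else stein_branch z w)"

text \<open>The left derivative of \<open>stein_sol\<close>.\<close>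
definition stein_sol_deriv :: "real \<Rightarrow> real \<Rightarrow> real" where
  "stein_sol_deriv z w =
    (if w \<le> z then - stein_branch_deriv (- z) (- w) else stein_branch_deriv z w)"

text \<open>Continuity at the break: it lets Lipschitz bounds of the two branches be pasted at z
  although the derivative jumps there.\<close>

lemma stein_sol_at_break: "stein_branch (- z) (- z) = stein_branch z z"
  by (simp add: stein_branch_def mills_def normal_cdf_minus std_normal_density_minus)

text \<open>Taking the left derivative at z matches the closed ray in the indicator. The identity
  therefore holds at every w, and sums with an atom at z need no exception.\<close>

lemma stein_equation:
  "stein_sol_deriv z w - w * stein_sol z w = indicator {..z} w - normal_cdf z"
  by (auto simp: stein_sol_deriv_def stein_sol_def stein_branch_deriv_def normal_cdf_minus)

lemma stein_sol_bound: "\<bar>stein_sol z w\<bar> \<le> 8"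
  using stein_branch_bounds(1,2)[of "-z" "-w"] stein_branch_bounds(1,2)[of "z" "w"]
  by (auto simp: stein_sol_def)

lemma stein_sol_deriv_bound: "\<bar>stein_sol_deriv z w\<bar> \<le> 2"
  using stein_branch_bounds(4)[of "-z" "-w"] stein_branch_bounds(4)[of "z" "w"]
  by (auto simp: stein_sol_deriv_def)

lemma borel_measurable_stein_sol [measurable]: "stein_sol z \<in> borel_measurable borel"
  unfolding stein_sol_def stein_branch_def by measurable

lemma borel_measurable_stein_sol_deriv [measurable]: "stein_sol_deriv z \<in> borel_measurable borel"
  unfolding stein_sol_deriv_def stein_branch_deriv_def stein_branch_def by measurable

lemma stein_sol_lipschitz: "\<bar>stein_sol z v - stein_sol z u\<bar> \<le> 2 * \<bar>v - u\<bar>"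
proof (induction u v rule: linorder_wlog)
  case (le u v)
  consider "v \<le> z" | "z < u" | "u \<le> z" "z < v" by linarith
  then show ?case
  proof cases
    case 1
    then show ?thesis using le stein_branch_lipschitz[of "-z" "-v" "-u"] by (simp add: stein_sol_def)
  next
    case 2
    then show ?thesis using le stein_branch_lipschitz[of z v u] by (simp add: stein_sol_def)
  next
    case 3
    then show ?thesis
      using stein_branch_lipschitz[of "-z" "-z" "-u"] stein_branch_lipschitz[of z v z]
      by (simp add: stein_sol_def stein_sol_at_break)
  qed
qed (simp add: abs_minus_commute)

text \<open>Controls the derivative over a step x from w. The 4 is twice the bound 2 on the
  derivative and is paid when the step may cross z; the second term is the smooth part. For
  \<bar>x\<bar> > 1 the second term is at least 10 and covers the crossing alone, so the band may be
  capped at half-width 1.\<close>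

definition stein_modulus :: "real \<Rightarrow> real \<Rightarrow> real \<Rightarrow> real" where
  "stein_modulus z x w = (if \<bar>w - z\<bar> \<le> min \<bar>x\<bar> 1 then 4 else 0) + 10 * min \<bar>x\<bar> 1 * (1 + \<bar>w\<bar>)"

lemma stein_modulus_nonneg: "0 \<le> stein_modulus z x w"
  by (simp add: stein_modulus_def)

lemma borel_measurable_stein_modulus [measurable]:
  "(\<lambda>p. stein_modulus z (fst p) (snd p)) \<in> borel_measurable (borel \<Otimes>\<^sub>M borel)"
  unfolding stein_modulus_def by measurable

lemma stein_modulus_ge_4:
  assumes "\<bar>w - z\<bar> \<le> \<bar>x\<bar> \<or> 1 < \<bar>x\<bar>"
  shows "4 \<le> stein_modulus z x w"
proof (cases "1 < \<bar>x\<bar>")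
  case False
  then show ?thesis using assms by (simp add: stein_modulus_def)
qed (simp add: stein_modulus_def)

lemma stein_modulus_ge: "\<bar>x\<bar> \<le> 1 \<Longrightarrow> 10 * \<bar>x\<bar> * (1 + \<bar>w\<bar>) \<le> stein_modulus z x w"
  by (simp add: stein_modulus_def)

lemma stein_sol_deriv_modulus:
  "\<bar>stein_sol_deriv z (w + x) - stein_sol_deriv z w\<bar> \<le> stein_modulus z x w"
proof (cases "\<bar>w - z\<bar> \<le> \<bar>x\<bar> \<or> 1 < \<bar>x\<bar>")
  case True
  show ?thesis
    using stein_modulus_ge_4[OF True] stein_sol_deriv_bound[of z w] stein_sol_deriv_bound[of z "w + x"]
    by linarith
next
  case False
  \<comment> \<open>Now \<bar>x\<bar> < \<bar>w - z\<bar>, so w and w + x lie on the same side of z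
    and a single branch is involved.\<close>
  then have "\<bar>stein_sol_deriv z (w + x) - stein_sol_deriv z w\<bar> \<le> 10 * \<bar>x\<bar> * (1 + \<bar>w\<bar>)"
    using stein_branch_deriv_lipschitz[of z w "w + x"]
      stein_branch_deriv_lipschitz[of "-z" "-w" "- w - x"]
    by (auto simp: stein_sol_deriv_def)
  then show ?thesis using stein_modulus_ge[of x w z] False by simp
qed

lemma stein_sol_taylor:
  "\<bar>stein_sol z (w + x) - stein_sol z w - x * stein_sol_deriv z w\<bar> \<le> \<bar>x\<bar> * stein_modulus z x w"
proof (cases "\<bar>w - z\<bar> \<le> \<bar>x\<bar> \<or> 1 < \<bar>x\<bar>")
  case True
  \<comment> \<open>No expansion is available here: the increment and the linear term are bounded
    separately, each by 2 \<bar>x\<bar>.\<close>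
  have "\<bar>x * stein_sol_deriv z w\<bar> \<le> \<bar>x\<bar> * 2"
    unfolding abs_mult by (intro mult_left_mono stein_sol_deriv_bound) auto
  then have "\<bar>stein_sol z (w + x) - stein_sol z w - x * stein_sol_deriv z w\<bar> \<le> \<bar>x\<bar> * 4"
    using stein_sol_lipschitz[of z "w + x" w] by simp
  also have "\<dots> \<le> \<bar>x\<bar> * stein_modulus z x w"
    by (intro mult_left_mono stein_modulus_ge_4 True) auto
  finally show ?thesis .
next
  case False
  have "\<bar>stein_sol z (w + x) - stein_sol z w - x * stein_sol_deriv z w\<bar>
      \<le> \<bar>x\<bar> * (10 * \<bar>x\<bar> * (1 + \<bar>w\<bar>))"
  proof (cases "w \<le> z")
    case True
    then show ?thesis using False stein_branch_taylor[of "-z" "-w" "- w - x"]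
      by (auto simp: stein_sol_def stein_sol_deriv_def)
  next
    case outer: False
    then show ?thesis using False stein_branch_taylor[of z w "w + x"]
      by (auto simp: stein_sol_def stein_sol_deriv_def)
  qed
  also have "\<dots> \<le> \<bar>x\<bar> * stein_modulus z x w"
    using False by (intro mult_left_mono stein_modulus_ge) auto
  finally show ?thesis .
qed

subsection \<open>A concentration inequality\<close>

lemma integrable_mult_bounded:
  fixes X F :: "'a \<Rightarrow> real"
  assumes "integrable M X" "F \<in> borel_measurable M" "\<And>\<omega>. \<bar>F \<omega>\<bar> \<le> c"
  shows "integrable M (\<lambda>\<omega>. X \<omega> * F \<omega>)"
proof (rule Bochner_Integration.integrable_bound[OF integrable_mult_right[OF assms(1), of c]])
  show "(\<lambda>\<omega>. X \<omega> * F \<omega>) \<in> borel_measurable M" using assms(1,2) by auto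
  have "\<bar>X \<omega>\<bar> * \<bar>F \<omega>\<bar> \<le> \<bar>X \<omega>\<bar> * \<bar>c\<bar>" for \<omega>
    using assms(3)[of \<omega>] by (intro mult_left_mono) auto
  then show "AE \<omega> in M. norm (X \<omega> * F \<omega>) \<le> norm (c * X \<omega>)"
    by (simp add: abs_mult mult.commute)
qed

text \<open>The cross term pairs a centred variable with an independent sum, so it is integrable
  with mean 0. Besides the partial sums this also serves the centred gains in the concentration
  argument.\<close>

lemma (in prob_space) indep_vars_square_sum:
  fixes X :: "'i \<Rightarrow> 'a \<Rightarrow> real"
  assumes "finite J" "indep_vars (\<lambda>_. borel) X J"
    and "\<And>i. i \<in> J \<Longrightarrow> integrable M (X i)"
    and "\<And>i. i \<in> J \<Longrightarrow> integrable M (\<lambda>\<omega>. (X i \<omega>)\<^sup>2)"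
    and "\<And>i. i \<in> J \<Longrightarrow> expectation (X i) = 0"
  shows "integrable M (\<lambda>\<omega>. (\<Sum>i\<in>J. X i \<omega>)\<^sup>2) \<and>
    expectation (\<lambda>\<omega>. (\<Sum>i\<in>J. X i \<omega>)\<^sup>2) = (\<Sum>i\<in>J. expectation (\<lambda>\<omega>. (X i \<omega>)\<^sup>2))"
  using assms
proof (induction J rule: finite_induct)
  case (insert i J)
  let ?S = "\<lambda>\<omega>. \<Sum>j\<in>J. X j \<omega>"
  have IH: "integrable M (\<lambda>\<omega>. (?S \<omega>)\<^sup>2)"
    "expectation (\<lambda>\<omega>. (?S \<omega>)\<^sup>2) = (\<Sum>i\<in>J. expectation (\<lambda>\<omega>. (X i \<omega>)\<^sup>2))"
    using insert.IH insert.prems indep_vars_subset[of _ X "insert i J" J] by auto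
  have ind: "indep_var borel (X i) borel ?S"
    using insert by (intro indep_vars_sum) auto
  have int: "integrable M (X i)" "integrable M ?S" "integrable M (\<lambda>\<omega>. (X i \<omega>)\<^sup>2)"
    using insert.prems by auto
  have cross: "integrable M (\<lambda>\<omega>. X i \<omega> * ?S \<omega>)" "expectation (\<lambda>\<omega>. X i \<omega> * ?S \<omega>) = 0"
    using indep_var_integrable[OF ind int(1,2)] indep_var_lebesgue_integral[OF ind int(1,2)]
      insert.prems(4) by auto
  have eq: "(\<Sum>j\<in>insert i J. X j \<omega>)\<^sup>2 = (X i \<omega>)\<^sup>2 + 2 * (X i \<omega> * ?S \<omega>) + (?S \<omega>)\<^sup>2" for \<omega>
    using insert.hyps by (simp add: power2_sum mult_ac)
  show ?case
    unfolding eq using IH int cross insert.hyps by simp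
qed simp

text \<open>Conditioning on X by Tonelli on the product law: freeze x, bound the inner mean by
  \<open>g x\<close>, then average. Nonnegativity of h makes integrability at the random point a
  conclusion, with pointwise information in x as the only input.\<close>

lemma (in prob_space) indep_var_integral_le:
  fixes X Y :: "'a \<Rightarrow> real" and h :: "real \<Rightarrow> real \<Rightarrow> real"
  assumes ind: "indep_var borel X borel Y"
    and h[measurable]: "(\<lambda>p. h (fst p) (snd p)) \<in> borel_measurable (borel \<Otimes>\<^sub>M borel)"
    and nonneg: "\<And>x y. 0 \<le> h x y"
    and int: "\<And>x. integrable M (\<lambda>\<omega>. h x (Y \<omega>))"
    and le: "\<And>x. expectation (\<lambda>\<omega>. h x (Y \<omega>)) \<le> g x"
    and g: "integrable M (\<lambda>\<omega>. g (X \<omega>))"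
  shows "integrable M (\<lambda>\<omega>. h (X \<omega>) (Y \<omega>))"
    and "expectation (\<lambda>\<omega>. h (X \<omega>) (Y \<omega>)) \<le> expectation (\<lambda>\<omega>. g (X \<omega>))"
proof -
  have X[measurable]: "random_variable borel X" and Y[measurable]: "random_variable borel Y"
    and D: "distr M borel X \<Otimes>\<^sub>M distr M borel Y = distr M (borel \<Otimes>\<^sub>M borel) (\<lambda>\<omega>. (X \<omega>, Y \<omega>))"
    using ind unfolding indep_var_distribution_eq by auto
  interpret Y: prob_space "distr M borel Y" by (rule prob_space_distr) (rule Y)
  have hXY[measurable]: "(\<lambda>\<omega>. h (X \<omega>) (Y \<omega>)) \<in> borel_measurable M"
    using measurable_compose[OF measurable_Pair[OF X Y] h] by simp
  have hx: "(\<lambda>y. h x y) \<in> borel_measurable borel" for x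
    using measurable_compose[OF measurable_Pair1'[of x borel borel] h] by simp
  have g0: "0 \<le> g x" for x
    by (rule order_trans[OF integral_nonneg_AE le]) (simp add: nonneg)
  have "(\<integral>\<^sup>+\<omega>. h (X \<omega>) (Y \<omega>) \<partial>M)
      = (\<integral>\<^sup>+p. h (fst p) (snd p) \<partial>(distr M (borel \<Otimes>\<^sub>M borel) (\<lambda>\<omega>. (X \<omega>, Y \<omega>))))"
    by (subst nn_integral_distr) auto
  also have "\<dots> = (\<integral>\<^sup>+p. h (fst p) (snd p) \<partial>(distr M borel X \<Otimes>\<^sub>M distr M borel Y))"
    by (simp only: D)
  also have "\<dots> = (\<integral>\<^sup>+x. (\<integral>\<^sup>+y. h x y \<partial>distr M borel Y) \<partial>distr M borel X)"
    by (subst Y.nn_integral_fst[symmetric]) (auto simp: measurable_ident_sets)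
  also have "\<dots> = (\<integral>\<^sup>+x. (\<integral>\<^sup>+\<omega>. h x (Y \<omega>) \<partial>M) \<partial>distr M borel X)"
    using hx by (intro nn_integral_cong nn_integral_distr) auto
  also have "\<dots> = (\<integral>\<^sup>+x. ennreal (expectation (\<lambda>\<omega>. h x (Y \<omega>))) \<partial>distr M borel X)"
    using int nonneg by (intro nn_integral_cong nn_integral_eq_integral) auto
  also have "\<dots> = (\<integral>\<^sup>+\<omega>. ennreal (expectation (\<lambda>\<omega>'. h (X \<omega>) (Y \<omega>'))) \<partial>M)"
  proof -
    have "(\<lambda>x. \<integral>y. h x y \<partial>distr M borel Y) \<in> borel_measurable borel"
      by (rule Y.borel_measurable_lebesgue_integral)
        (use h in \<open>simp add: case_prod_beta' cong: measurable_cong_sets\<close>)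
    then have "(\<lambda>x. expectation (\<lambda>\<omega>. h x (Y \<omega>))) \<in> borel_measurable borel"
      by (subst (asm) integral_distr) (use hx in auto)
    then have "(\<lambda>x. ennreal (expectation (\<lambda>\<omega>. h x (Y \<omega>)))) \<in> borel_measurable borel"
      by simp
    then show ?thesis by (subst nn_integral_distr[OF X]) (simp_all only: measurable_distr_eq1)
  qed
  also have "\<dots> \<le> (\<integral>\<^sup>+\<omega>. ennreal (g (X \<omega>)) \<partial>M)"
    by (intro nn_integral_mono ennreal_leI le)
  also have "\<dots> = ennreal (expectation (\<lambda>\<omega>. g (X \<omega>)))"
    using g g0 by (intro nn_integral_eq_integral) auto
  finally have *: "(\<integral>\<^sup>+\<omega>. h (X \<omega>) (Y \<omega>) \<partial>M) \<le> ennreal (expectation (\<lambda>\<omega>. g (X \<omega>)))" .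
  show int: "integrable M (\<lambda>\<omega>. h (X \<omega>) (Y \<omega>))"
    using * nonneg by (intro integrableI_nonneg) (auto intro: le_less_trans)
  show "expectation (\<lambda>\<omega>. h (X \<omega>) (Y \<omega>)) \<le> expectation (\<lambda>\<omega>. g (X \<omega>))"
  proof (rule iffD1[OF ennreal_le_iff])
    show "0 \<le> expectation (\<lambda>\<omega>. g (X \<omega>))"
      by (intro Bochner_Integration.integral_nonneg g0)
    show "ennreal (expectation (\<lambda>\<omega>. h (X \<omega>) (Y \<omega>))) \<le> ennreal (expectation (\<lambda>\<omega>. g (X \<omega>)))"
      by (rule order_trans[OF eq_refl *], rule nn_integral_eq_integral[symmetric, OF int])
        (simp add: nonneg)
  qed
qed

text \<open>Inside the band, w - z keeps distance at least \<open>\<delta>\<close> from both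
  clamping levels, so undoing a step x moves h by at least min \<open>\<delta>\<close>
  \<bar>x\<bar>. Outside, monotonicity of h makes the right side nonnegative.\<close>

lemma clamp_increment:
  fixes x w z m \<delta> :: real
  assumes "0 \<le> m" "0 < \<delta>"
  defines "h \<equiv> \<lambda>w. max (- (m + \<delta>)) (min (m + \<delta>) (w - z))"
  shows "indicator {w. \<bar>w - z\<bar> \<le> m} w * (\<bar>x\<bar> * min \<delta> \<bar>x\<bar>) \<le> x * (h w - h (w - x))"
proof (cases "\<bar>w - z\<bar> \<le> m")
  case True
  show ?thesis
  proof (cases "0 \<le> x")
    case x: True
    have "min \<delta> x \<le> h w - h (w - x)" using True assms x by (auto simp: h_def)
    then show ?thesis using True x by (simp add: mult_left_mono)
  next
    case x: False
    have "min \<delta> (- x) \<le> h (w - x) - h w" using True assms x by (auto simp: h_def)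
    then have "(- x) * min \<delta> (- x) \<le> (- x) * (h (w - x) - h w)"
      using x by (intro mult_left_mono) auto
    then show ?thesis using True x by (simp add: algebra_simps)
  qed
next
  case False
  show ?thesis
  proof (cases "0 \<le> x")
    case x: True
    then have "0 \<le> h w - h (w - x)" by (auto simp: h_def)
    then show ?thesis using False x by simp
  next
    case x: False
    then have "h w - h (w - x) \<le> 0" by (auto simp: h_def)
    then show ?thesis using False x by (simp add: mult_nonpos_nonpos)
  qed
qed

section \<open>Sums of centred independent variables\<close>

locale centered_indep_family = prob_space M for M :: "'a measure" +
  fixes X :: "'i \<Rightarrow> 'a \<Rightarrow> real" and I :: "'i set"
  assumes finite_I: "finite I"
    and indep: "indep_vars (\<lambda>_. borel) X I"
    and int_X: "\<And>i. i \<in> I \<Longrightarrow> integrable M (X i)"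
    and int_X2: "\<And>i. i \<in> I \<Longrightarrow> integrable M (\<lambda>\<omega>. (X i \<omega>)\<^sup>2)"
    and mean_X: "\<And>i. i \<in> I \<Longrightarrow> expectation (X i) = 0"
begin

abbreviation S :: "'i set \<Rightarrow> 'a \<Rightarrow> real" where
  "S J \<omega> \<equiv> \<Sum>i\<in>J. X i \<omega>"

abbreviation var :: "'i \<Rightarrow> real" where
  "var i \<equiv> expectation (\<lambda>\<omega>. (X i \<omega>)\<^sup>2)"

lemma measurable_X: "i \<in> I \<Longrightarrow> X i \<in> borel_measurable M"
  using int_X by blast

lemma S_facts:
  assumes "J \<subseteq> I"
  shows integrable_S: "integrable M (S J)"
    and integrable_S_square: "integrable M (\<lambda>\<omega>. (S J \<omega>)\<^sup>2)"
    and expectation_S_square: "expectation (\<lambda>\<omega>. (S J \<omega>)\<^sup>2) = (\<Sum>i\<in>J. var i)"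
    and measurable_S: "S J \<in> borel_measurable M"
proof -
  have "finite J" using assms finite_I finite_subset by blast
  have "integrable M (\<lambda>\<omega>. (S J \<omega>)\<^sup>2) \<and> expectation (\<lambda>\<omega>. (S J \<omega>)\<^sup>2) = (\<Sum>i\<in>J. var i)"
    using assms int_X int_X2 mean_X \<open>finite J\<close>
    by (intro indep_vars_square_sum indep_vars_subset[OF indep]) auto
  then show "integrable M (\<lambda>\<omega>. (S J \<omega>)\<^sup>2)" "expectation (\<lambda>\<omega>. (S J \<omega>)\<^sup>2) = (\<Sum>i\<in>J. var i)"
    by auto
  show "integrable M (S J)" using assms int_X by (intro Bochner_Integration.integrable_sum) auto
  then show "S J \<in> borel_measurable M" by blast
qed

lemma indep_var_leave_one_out:
  assumes "J \<subseteq> I" "i \<in> J"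
  shows "indep_var borel (X i) borel (S (J - {i}))"
  using assms finite_I
  by (intro indep_vars_sum indep_vars_subset[OF indep]) (auto intro: finite_subset)

lemma expectation_mult_leave_one_out:
  fixes \<phi> \<psi> :: "real \<Rightarrow> real"
  assumes "J \<subseteq> I" "i \<in> J" and [measurable]: "\<phi> \<in> borel_measurable borel" "\<psi> \<in> borel_measurable borel"
    and "integrable M (\<lambda>\<omega>. \<phi> (X i \<omega>))" "integrable M (\<lambda>\<omega>. \<psi> (S (J - {i}) \<omega>))"
  shows "integrable M (\<lambda>\<omega>. \<phi> (X i \<omega>) * \<psi> (S (J - {i}) \<omega>))"
    and "expectation (\<lambda>\<omega>. \<phi> (X i \<omega>) * \<psi> (S (J - {i}) \<omega>))
      = expectation (\<lambda>\<omega>. \<phi> (X i \<omega>)) * expectation (\<lambda>\<omega>. \<psi> (S (J - {i}) \<omega>))"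
proof -
  have "indep_var borel (\<phi> \<circ> X i) borel (\<psi> \<circ> S (J - {i}))"
    by (rule indep_var_compose[OF indep_var_leave_one_out[OF assms(1,2)]]) auto
  then have *: "indep_var borel (\<lambda>\<omega>. \<phi> (X i \<omega>)) borel (\<lambda>\<omega>. \<psi> (S (J - {i}) \<omega>))"
    by (simp add: comp_def)
  show "integrable M (\<lambda>\<omega>. \<phi> (X i \<omega>) * \<psi> (S (J - {i}) \<omega>))"
    by (rule indep_var_integrable[OF * assms(5,6)])
  show "expectation (\<lambda>\<omega>. \<phi> (X i \<omega>) * \<psi> (S (J - {i}) \<omega>))
      = expectation (\<lambda>\<omega>. \<phi> (X i \<omega>)) * expectation (\<lambda>\<omega>. \<psi> (S (J - {i}) \<omega>))"
    by (rule indep_var_lebesgue_integral[OF * assms(5,6)])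
qed

lemma expectation_abs_S_le:
  assumes "J \<subseteq> I" "(\<Sum>i\<in>J. var i) \<le> 1"
  shows "expectation (\<lambda>\<omega>. \<bar>S J \<omega>\<bar>) \<le> 1"
proof -
  have "expectation (\<lambda>\<omega>. \<bar>S J \<omega>\<bar>) \<le> expectation (\<lambda>\<omega>. 1 / 2 + (S J \<omega>)\<^sup>2 / 2)"
  proof (rule integral_mono)
    fix \<omega>
    have "0 \<le> (\<bar>S J \<omega>\<bar> - 1)\<^sup>2" by simp
    then show "\<bar>S J \<omega>\<bar> \<le> 1 / 2 + (S J \<omega>)\<^sup>2 / 2" by (simp add: power2_diff)
  qed (use S_facts[OF assms(1)] in auto)
  also have "\<dots> = 1 / 2 + (\<Sum>i\<in>J. var i) / 2"
    using S_facts[OF assms(1)] by (simp add: prob_space)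
  finally show ?thesis using assms(2) by simp
qed

text \<open>Test \<open>E (S h(S))\<close> against the clamp \<open>h\<close> of slope one on a \<open>\<delta>\<close>-neighbourhood of the
  interval: every summand moves \<open>h\<close> by at least \<open>min \<delta> \<bar>X\<^sub>j\<bar>\<close> when \<open>S\<close> lies in the interval, and
  the sum \<open>U\<close> of these gains concentrates around its mean because its variance is at most \<open>\<delta>\<^sup>2\<close>.\<close>
lemma concentration:
  fixes z m \<delta> :: real
  assumes J: "J \<subseteq> I" and var_le: "(\<Sum>i\<in>J. var i) \<le> 1" and m: "0 \<le> m" and \<delta>: "0 < \<delta>"
    and gain: "1 / 2 \<le> (\<Sum>j\<in>J. expectation (\<lambda>\<omega>. \<bar>X j \<omega>\<bar> * min \<delta> \<bar>X j \<omega>\<bar>))"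
  shows "\<P>(\<omega> in M. \<bar>S J \<omega> - z\<bar> \<le> m) \<le> 2 * m + 4 * \<delta>"
proof -
  define v where "v = (\<lambda>x::real. \<bar>x\<bar> * min \<delta> \<bar>x\<bar>)"
  define h where "h = (\<lambda>w. max (- (m + \<delta>)) (min (m + \<delta>) (w - z)))"
  define \<mu> where "\<mu> = (\<lambda>j. expectation (\<lambda>\<omega>. v (X j \<omega>)))"
  define U where "U = (\<lambda>\<omega>. \<Sum>j\<in>J. v (X j \<omega>))"
  let ?A = "{\<omega> \<in> space M. \<bar>S J \<omega> - z\<bar> \<le> m}"
  have "finite J" using J finite_I finite_subset by blast
  have [measurable]: "v \<in> borel_measurable borel" "h \<in> borel_measurable borel"
    "S J \<in> borel_measurable M" "\<And>j. j \<in> J \<Longrightarrow> X j \<in> borel_measurable M"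
    using measurable_S[OF J] J measurable_X by (auto simp: v_def[abs_def] h_def[abs_def])
  have h_bound: "\<bar>h w\<bar> \<le> m + \<delta>" for w using m \<delta> by (auto simp: h_def)
  have v_bounds: "0 \<le> v x" "v x \<le> \<delta> * \<bar>x\<bar>" "(v x)\<^sup>2 \<le> \<delta>\<^sup>2 * x\<^sup>2" for x
  proof -
    show 0: "0 \<le> v x" using \<delta> by (simp add: v_def)
    show 1: "v x \<le> \<delta> * \<bar>x\<bar>" using mult_left_mono[of "min \<delta> \<bar>x\<bar>" \<delta> "\<bar>x\<bar>"] by (simp add: v_def mult.commute)
    show "(v x)\<^sup>2 \<le> \<delta>\<^sup>2 * x\<^sup>2" using power_mono[OF 1 0, of 2] by (simp add: power_mult_distrib)
  qed
  have int_v: "integrable M (\<lambda>\<omega>. v (X j \<omega>))" and int_v2: "integrable M (\<lambda>\<omega>. (v (X j \<omega>))\<^sup>2)"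
    if "j \<in> J" for j
  proof -
    have "j \<in> I" using that J by blast
    have 1: "integrable M (\<lambda>\<omega>. \<delta> * \<bar>X j \<omega>\<bar>)" and 2: "integrable M (\<lambda>\<omega>. \<delta>\<^sup>2 * (X j \<omega>)\<^sup>2)"
      using int_X[OF \<open>j \<in> I\<close>] int_X2[OF \<open>j \<in> I\<close>] by auto
    note [measurable] = that
    show "integrable M (\<lambda>\<omega>. v (X j \<omega>))"
      by (rule Bochner_Integration.integrable_bound[OF 1])
        (use v_bounds \<delta> in \<open>auto simp: abs_mult\<close>)
    show "integrable M (\<lambda>\<omega>. (v (X j \<omega>))\<^sup>2)"
      by (rule Bochner_Integration.integrable_bound[OF 2]) (use v_bounds(3) in auto)
  qed
  have int_U: "integrable M U" and EU: "expectation U = (\<Sum>j\<in>J. \<mu> j)"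
    using int_v by (auto simp: U_def \<mu>_def)
  have U_var: "integrable M (\<lambda>\<omega>. (U \<omega> - expectation U)\<^sup>2)"
    "expectation (\<lambda>\<omega>. (U \<omega> - expectation U)\<^sup>2) \<le> \<delta>\<^sup>2"
  proof -
    let ?V = "\<lambda>j \<omega>. v (X j \<omega>) - \<mu> j"
    have sq: "(?V j \<omega>)\<^sup>2 = (v (X j \<omega>))\<^sup>2 - 2 * \<mu> j * v (X j \<omega>) + (\<mu> j)\<^sup>2" for j \<omega>
      by (simp add: power2_diff algebra_simps)
    have V2: "integrable M (\<lambda>\<omega>. (?V j \<omega>)\<^sup>2)" if "j \<in> J" for j
      unfolding sq using that int_v int_v2 by simp
    have eq: "U \<omega> - expectation U = (\<Sum>j\<in>J. ?V j \<omega>)" for \<omega>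
      unfolding EU by (simp add: U_def sum_subtractf)
    have ind: "indep_vars (\<lambda>_. borel) ?V J"
      by (rule indep_vars_compose2[OF indep_vars_subset[OF indep J]]) simp
    have *: "integrable M (\<lambda>\<omega>. (\<Sum>j\<in>J. ?V j \<omega>)\<^sup>2) \<and>
        expectation (\<lambda>\<omega>. (\<Sum>j\<in>J. ?V j \<omega>)\<^sup>2) = (\<Sum>j\<in>J. expectation (\<lambda>\<omega>. (?V j \<omega>)\<^sup>2))"
      using int_v V2 by (intro indep_vars_square_sum ind \<open>finite J\<close>) (auto simp: \<mu>_def prob_space)
    show "integrable M (\<lambda>\<omega>. (U \<omega> - expectation U)\<^sup>2)" unfolding eq using * by blast
    have "expectation (\<lambda>\<omega>. (U \<omega> - expectation U)\<^sup>2) = (\<Sum>j\<in>J. expectation (\<lambda>\<omega>. (?V j \<omega>)\<^sup>2))"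
      unfolding eq using * by blast
    \<comment> \<open>Each gain is at most \<open>\<delta> * \<bar>x\<bar>\<close>, so its variance
      is at most \<open>\<delta>\<^sup>2\<close> times the second moment of the summand.\<close>
    also have "\<dots> \<le> (\<Sum>j\<in>J. \<delta>\<^sup>2 * var j)"
    proof (rule sum_mono)
      fix j assume j: "j \<in> J"
      have "expectation (\<lambda>\<omega>. (?V j \<omega>)\<^sup>2) = expectation (\<lambda>\<omega>. (v (X j \<omega>))\<^sup>2) - (\<mu> j)\<^sup>2"
        unfolding sq using int_v[OF j] int_v2[OF j]
        by (simp add: prob_space power2_eq_square) (simp add: \<mu>_def)
      also have "\<dots> \<le> expectation (\<lambda>\<omega>. \<delta>\<^sup>2 * (X j \<omega>)\<^sup>2)"
      proof -
        have "expectation (\<lambda>\<omega>. (v (X j \<omega>))\<^sup>2) \<le> expectation (\<lambda>\<omega>. \<delta>\<^sup>2 * (X j \<omega>)\<^sup>2)"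
          using int_v2[OF j] int_X2 j J v_bounds(3) by (intro integral_mono) auto
        then show ?thesis using zero_le_power2[of "\<mu> j"] by linarith
      qed
      finally show "expectation (\<lambda>\<omega>. (?V j \<omega>)\<^sup>2) \<le> \<delta>\<^sup>2 * var j" by simp
    qed
    also have "\<dots> \<le> \<delta>\<^sup>2 * 1"
      unfolding sum_distrib_left[symmetric] by (intro mult_left_mono var_le) auto
    finally show "expectation (\<lambda>\<omega>. (U \<omega> - expectation U)\<^sup>2) \<le> \<delta>\<^sup>2" by simp
  qed
  have int_term: "integrable M (\<lambda>\<omega>. X j \<omega> * h (S J \<omega>))" "integrable M (\<lambda>\<omega>. X j \<omega> * h (S (J - {j}) \<omega>))"
    if "j \<in> J" for j
  proof -
    have "j \<in> I" "J - {j} \<subseteq> I" using that J by auto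
    note [measurable] = measurable_S[OF \<open>J - {j} \<subseteq> I\<close>]
    show "integrable M (\<lambda>\<omega>. X j \<omega> * h (S J \<omega>))" "integrable M (\<lambda>\<omega>. X j \<omega> * h (S (J - {j}) \<omega>))"
      by (rule integrable_mult_bounded[OF int_X[OF \<open>j \<in> I\<close>] _ h_bound], measurable)+
  qed
  have zero: "expectation (\<lambda>\<omega>. X j \<omega> * h (S (J - {j}) \<omega>)) = 0" if "j \<in> J" for j
  proof -
    have "j \<in> I" "J - {j} \<subseteq> I" using that J by auto
    have "integrable M (\<lambda>\<omega>. h (S (J - {j}) \<omega>))"
      using h_bound measurable_S[OF \<open>J - {j} \<subseteq> I\<close>]
      by (intro integrable_const_bound[of _ "m + \<delta>"]) auto
    then show ?thesis
      using expectation_mult_leave_one_out(2)[of J j "\<lambda>x. x" h] that J int_X[OF \<open>j \<in> I\<close>]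
        mean_X[OF \<open>j \<in> I\<close>] by auto
  qed
  have A[measurable]: "?A \<in> sets M" by measurable
  \<comment> \<open>This exchanges U for its mean on the event. The error \<bar>U - E U\<bar> is at
    most \<open>\<delta> / 2\<close> plus (U - E U)^2 / (2 \<delta>) by AM-GM, and the variance
    bound makes the mean of that at most \<open>\<delta>\<close>.\<close>
  have "expectation U * prob ?A - \<delta>
      \<le> expectation (\<lambda>\<omega>. expectation U * indicator ?A \<omega> - (\<delta> / 2 + (U \<omega> - expectation U)\<^sup>2 / (2 * \<delta>)))"
  proof -
    have "expectation (\<lambda>\<omega>. (U \<omega> - expectation U)\<^sup>2) / (2 * \<delta>) \<le> \<delta>\<^sup>2 / (2 * \<delta>)"
      using U_var(2) \<delta> by (intro divide_right_mono) auto
    then have "expectation (\<lambda>\<omega>. (U \<omega> - expectation U)\<^sup>2) / (2 * \<delta>) \<le> \<delta> / 2"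
      using \<delta> by (simp add: power2_eq_square)
    then show ?thesis using U_var(1) A by (simp add: prob_space emeasure_eq_measure)
  qed
  also have "\<dots> \<le> expectation (\<lambda>\<omega>. \<Sum>j\<in>J. X j \<omega> * h (S J \<omega>) - X j \<omega> * h (S (J - {j}) \<omega>))"
  proof (rule integral_mono)
    fix \<omega> assume \<omega>: "\<omega> \<in> space M"
    let ?d = "U \<omega> - expectation U"
    have "0 \<le> (\<bar>?d\<bar> - \<delta>)\<^sup>2" by simp
    then have "2 * \<delta> * \<bar>?d\<bar> \<le> \<delta>\<^sup>2 + ?d\<^sup>2" by (simp add: power2_diff algebra_simps)
    then have "\<bar>?d\<bar> \<le> \<delta> / 2 + ?d\<^sup>2 / (2 * \<delta>)"
      using \<delta> by (simp add: field_simps power2_eq_square)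
    then have "expectation U * indicator ?A \<omega> - (\<delta> / 2 + ?d\<^sup>2 / (2 * \<delta>)) \<le> indicator ?A \<omega> * U \<omega>"
      by (auto simp: indicator_def)
    also have "\<dots> = (\<Sum>j\<in>J. indicator {w. \<bar>w - z\<bar> \<le> m} (S J \<omega>) * v (X j \<omega>))"
      using \<omega> by (auto simp: U_def sum_distrib_left indicator_def)
    also have "\<dots> \<le> (\<Sum>j\<in>J. X j \<omega> * h (S J \<omega>) - X j \<omega> * h (S (J - {j}) \<omega>))"
    proof (rule sum_mono)
      fix j assume "j \<in> J"
      then have "S (J - {j}) \<omega> = S J \<omega> - X j \<omega>"
        using \<open>finite J\<close> by (simp add: sum_diff1)
      then show "indicator {w. \<bar>w - z\<bar> \<le> m} (S J \<omega>) * v (X j \<omega>)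
          \<le> X j \<omega> * h (S J \<omega>) - X j \<omega> * h (S (J - {j}) \<omega>)"
        using clamp_increment[OF m \<delta>, where w = "S J \<omega>" and x = "X j \<omega>" and z = z]
        by (simp add: h_def v_def right_diff_distrib)
    qed
    finally show "expectation U * indicator ?A \<omega> - (\<delta> / 2 + ?d\<^sup>2 / (2 * \<delta>))
      \<le> (\<Sum>j\<in>J. X j \<omega> * h (S J \<omega>) - X j \<omega> * h (S (J - {j}) \<omega>))" .
  qed (use U_var(1) int_term in \<open>auto simp: emeasure_eq_measure\<close>)
  \<comment> \<open>The subtracted terms vanish by independence and centring. What remains adds up
    to E (S h(S)), which is at most \<open>m + \<delta>\<close> because h is bounded by that and E
    \<bar>S\<bar> \<le> 1.\<close>
  also have "\<dots> = (\<Sum>j\<in>J. expectation (\<lambda>\<omega>. X j \<omega> * h (S J \<omega>)))"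
    using int_term zero by simp
  also have "\<dots> = expectation (\<lambda>\<omega>. S J \<omega> * h (S J \<omega>))"
    using int_term by (simp add: sum_distrib_right)
  also have "\<dots> \<le> expectation (\<lambda>\<omega>. \<bar>S J \<omega>\<bar> * (m + \<delta>))"
  proof (rule integral_mono)
    show "integrable M (\<lambda>\<omega>. S J \<omega> * h (S J \<omega>))"
      using int_term by (simp add: sum_distrib_right)
    show "integrable M (\<lambda>\<omega>. \<bar>S J \<omega>\<bar> * (m + \<delta>))" using integrable_S[OF J] by simp
    fix \<omega>
    have "\<bar>S J \<omega> * h (S J \<omega>)\<bar> \<le> \<bar>S J \<omega>\<bar> * (m + \<delta>)"
      unfolding abs_mult by (intro mult_left_mono h_bound) auto
    then show "S J \<omega> * h (S J \<omega>) \<le> \<bar>S J \<omega>\<bar> * (m + \<delta>)" by linarith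
  qed
  also have "\<dots> \<le> 1 * (m + \<delta>)"
    unfolding integral_mult_left_zero
    using expectation_abs_S_le[OF J var_le] m \<delta> by (intro mult_right_mono) auto
  finally have "expectation U * prob ?A \<le> m + 2 * \<delta>" by simp
  moreover have "1 / 2 * prob ?A \<le> expectation U * prob ?A"
    using gain by (intro mult_right_mono) (auto simp: EU \<mu>_def v_def)
  ultimately show ?thesis by simp
qed

end

subsection \<open>The normal approximation\<close>

text \<open>Converts smallness of the truncated third moments into the lower bound on gains that
  \<open>concentration\<close> requires. With a = \<bar>x\<bar> factored out, the case \<delta> < a
  \<le> 1 is (a - 2 \<delta>)^2 \<ge> 0; for a > 1 the condition \<delta> \<le> 1/4 makes the left
  side nonpositive.\<close>

lemma gain_lower_bound:
  fixes x \<delta> :: real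
  assumes "0 < \<delta>" "\<delta> \<le> 1 / 4"
  shows "x\<^sup>2 - x\<^sup>2 * min \<bar>x\<bar> 1 / (4 * \<delta>) \<le> \<bar>x\<bar> * min \<delta> \<bar>x\<bar>"
proof -
  define a where "a = \<bar>x\<bar>"
  have a: "0 \<le> a" "x\<^sup>2 = a\<^sup>2" "\<bar>x\<bar> = a" by (simp_all add: a_def)
  have "a - a * min a 1 / (4 * \<delta>) \<le> min \<delta> a"
  proof (cases "a \<le> \<delta>")
    case True
    then show ?thesis using a assms by simp
  next
    case False
    show ?thesis
    proof (cases "a \<le> 1")
      case True
      have "0 \<le> (a - 2 * \<delta>)\<^sup>2" by simp
      then have "4 * \<delta> * a - a * a \<le> \<delta> * (4 * \<delta>)" by (simp add: power2_eq_square algebra_simps)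
      then show ?thesis using False True assms by (simp add: field_simps)
    next
      case outer: False
      have "4 * \<delta> * a \<le> 1 * a" using assms a by (intro mult_right_mono) auto
      then have "a - a / (4 * \<delta>) \<le> 0" using assms by (simp add: field_simps)
      then show ?thesis using outer False assms by simp
    qed
  qed
  from mult_left_mono[OF this a(1)] show ?thesis
    unfolding a by (simp add: power2_eq_square right_diff_distrib mult.assoc)
qed

text \<open>Ensures that no single summand carries much variance, so leaving one out costs little.
  The two terms cover \<bar>x\<bar> below and above 1/4.\<close>

lemma square_le_truncated_cube: "(x::real)\<^sup>2 \<le> 1 / 16 + 4 * (x\<^sup>2 * min \<bar>x\<bar> 1)"
proof (cases "\<bar>x\<bar> \<le> 1 / 4")
  case True
  then have "\<bar>x\<bar>\<^sup>2 \<le> (1 / 4)\<^sup>2" by (intro power_mono) auto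
  then have "x\<^sup>2 \<le> 1 / 16" by (simp add: power_divide)
  then show ?thesis by (simp add: add_increasing2)
next
  case False
  then have "x\<^sup>2 * 1 \<le> x\<^sup>2 * (4 * min \<bar>x\<bar> 1)" by (intro mult_left_mono) auto
  then show ?thesis by (simp add: mult_ac)
qed

text \<open>Chebyshev's association inequality for two nondecreasing functions of
  \<bar>X\<bar>.\<close>

lemma (in prob_space) truncation_association:
  fixes X :: "'a \<Rightarrow> real"
  assumes int: "integrable M (\<lambda>\<omega>. (X \<omega>)\<^sup>2)" and [measurable]: "X \<in> borel_measurable M"
  shows "expectation (\<lambda>\<omega>. (X \<omega>)\<^sup>2) * expectation (\<lambda>\<omega>. min \<bar>X \<omega>\<bar> 1)
    \<le> expectation (\<lambda>\<omega>. (X \<omega>)\<^sup>2 * min \<bar>X \<omega>\<bar> 1)"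
proof -
  define \<mu> where "\<mu> = expectation (\<lambda>\<omega>. min \<bar>X \<omega>\<bar> 1)"
  have int1: "integrable M (\<lambda>\<omega>. min \<bar>X \<omega>\<bar> 1)"
    by (rule integrable_const_bound[of _ 1]) auto
  have int2: "integrable M (\<lambda>\<omega>. (X \<omega>)\<^sup>2 * min \<bar>X \<omega>\<bar> 1)"
    by (rule Bochner_Integration.integrable_bound[OF int])
      (auto simp: abs_mult intro!: mult_left_le)
  have "0 \<le> \<mu>" by (simp add: \<mu>_def)
  have "\<mu> \<le> expectation (\<lambda>_. 1)" unfolding \<mu>_def by (intro integral_mono int1) auto
  then have "\<mu> \<le> 1" by (simp add: prob_space)
  \<comment> \<open>Since \<open>\<mu> \<le> 1\<close>, both factors change sign at \<bar>X\<bar> =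
    \<open>\<mu>\<close>. In the mean, the part with \<open>\<mu>\<^sup>2\<close> cancels because
    \<open>\<mu>\<close> is the expectation of min \<bar>X\<bar> 1.\<close>
  have pos: "0 \<le> ((X \<omega>)\<^sup>2 - \<mu>\<^sup>2) * (min \<bar>X \<omega>\<bar> 1 - \<mu>)" for \<omega>
  proof (cases "\<mu> \<le> \<bar>X \<omega>\<bar>")
    case True
    then have "\<mu>\<^sup>2 \<le> (X \<omega>)\<^sup>2" using \<open>0 \<le> \<mu>\<close> power_mono[of \<mu> "\<bar>X \<omega>\<bar>" 2] by simp
    then show ?thesis using True \<open>\<mu> \<le> 1\<close> by simp
  next
    case False
    then have "(X \<omega>)\<^sup>2 \<le> \<mu>\<^sup>2" using power_mono[of "\<bar>X \<omega>\<bar>" \<mu> 2] by simp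
    then show ?thesis using False by (intro mult_nonpos_nonpos) auto
  qed
  have "0 \<le> expectation (\<lambda>\<omega>. ((X \<omega>)\<^sup>2 - \<mu>\<^sup>2) * (min \<bar>X \<omega>\<bar> 1 - \<mu>))"
    by (intro Bochner_Integration.integral_nonneg pos)
  also have "\<dots> = expectation (\<lambda>\<omega>. (X \<omega>)\<^sup>2 * min \<bar>X \<omega>\<bar> 1 - \<mu> * (X \<omega>)\<^sup>2
      - \<mu>\<^sup>2 * min \<bar>X \<omega>\<bar> 1 + \<mu>\<^sup>2 * \<mu>)"
    by (intro Bochner_Integration.integral_cong refl) (simp add: algebra_simps)
  also have "\<dots> = expectation (\<lambda>\<omega>. (X \<omega>)\<^sup>2 * min \<bar>X \<omega>\<bar> 1) - \<mu> * expectation (\<lambda>\<omega>. (X \<omega>)\<^sup>2)"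
    using int int1 int2 by (simp add: prob_space \<mu>_def[symmetric])
  finally show ?thesis by (simp add: \<mu>_def mult.commute)
qed

context centered_indep_family
begin

abbreviation trunc3 :: "'i \<Rightarrow> real" where
  "trunc3 i \<equiv> expectation (\<lambda>\<omega>. (X i \<omega>)\<^sup>2 * min \<bar>X i \<omega>\<bar> 1)"

lemma integrable_trunc:
  assumes "i \<in> I"
  shows "integrable M (\<lambda>\<omega>. (X i \<omega>)\<^sup>2 * min \<bar>X i \<omega>\<bar> 1)" "integrable M (\<lambda>\<omega>. min \<bar>X i \<omega>\<bar> 1)"
proof -
  note [measurable] = measurable_X[OF assms]
  show "integrable M (\<lambda>\<omega>. (X i \<omega>)\<^sup>2 * min \<bar>X i \<omega>\<bar> 1)"
    by (rule Bochner_Integration.integrable_bound[OF int_X2[OF assms]])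
      (auto simp: abs_mult intro!: mult_left_le)
  show "integrable M (\<lambda>\<omega>. min \<bar>X i \<omega>\<bar> 1)"
    by (rule integrable_const_bound[of _ 1]) auto
qed

text \<open>The budget is 1 - 1/8 - 1/4 \<ge> 1/2: the omitted variance is at most 1/16 + 4/64 =
  1/8, and the truncated third moments cost at most \<delta> / (4 \<delta>) = 1/4.\<close>

lemma leave_one_out_gain:
  assumes var1: "(\<Sum>i\<in>I. var i) = 1" and \<delta>: "0 < \<delta>" "\<delta> \<le> 1 / 64"
    and \<beta>: "(\<Sum>i\<in>I. trunc3 i) \<le> \<delta>" and i: "i \<in> I"
  shows "1 / 2 \<le> (\<Sum>j\<in>I - {i}. expectation (\<lambda>\<omega>. \<bar>X j \<omega>\<bar> * min \<delta> \<bar>X j \<omega>\<bar>))"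
proof -
  have nonneg: "0 \<le> trunc3 j" for j by (intro Bochner_Integration.integral_nonneg) auto
  have "trunc3 i \<le> (\<Sum>i\<in>I. trunc3 i)"
    using finite_I i nonneg by (intro member_le_sum) auto
  then have ti: "trunc3 i \<le> 1 / 64" using \<beta> \<delta> by linarith
  have "var i \<le> expectation (\<lambda>\<omega>. 1 / 16 + 4 * ((X i \<omega>)\<^sup>2 * min \<bar>X i \<omega>\<bar> 1))"
    using int_X2[OF i] integrable_trunc[OF i] square_le_truncated_cube by (intro integral_mono) auto
  also have "\<dots> = 1 / 16 + 4 * trunc3 i"
    using integrable_trunc[OF i] by (simp add: prob_space)
  finally have vi: "var i \<le> 1 / 8" using ti by simp
  have "(\<Sum>j\<in>I - {i}. trunc3 j) \<le> (\<Sum>j\<in>I. trunc3 j)"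
    using finite_I nonneg by (intro sum_mono2) auto
  then have "(\<Sum>j\<in>I - {i}. trunc3 j) / (4 * \<delta>) \<le> \<delta> / (4 * \<delta>)"
    using \<beta> \<delta> by (intro divide_right_mono) auto
  moreover have "\<delta> / (4 * \<delta>) = 1 / 4" using \<delta> by simp
  ultimately have "1 / 2 \<le> (1 - var i) - (\<Sum>j\<in>I - {i}. trunc3 j) / (4 * \<delta>)"
    using vi by linarith
  also have "\<dots> = (\<Sum>j\<in>I - {i}. var j - trunc3 j / (4 * \<delta>))"
  proof -
    have "(\<Sum>j\<in>I - {i}. var j) = 1 - var i" using finite_I i var1 by (simp add: sum_diff1)
    then show ?thesis by (simp only: sum_subtractf sum_divide_distrib)
  qed
  also have "\<dots> \<le> (\<Sum>j\<in>I - {i}. expectation (\<lambda>\<omega>. \<bar>X j \<omega>\<bar> * min \<delta> \<bar>X j \<omega>\<bar>))"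
  proof (rule sum_mono)
    fix j assume "j \<in> I - {i}"
    then have j: "j \<in> I" by simp
    note [measurable] = measurable_X[OF j]
    have int: "integrable M (\<lambda>\<omega>. \<bar>X j \<omega>\<bar> * min \<delta> \<bar>X j \<omega>\<bar>)"
      by (rule integrable_mult_bounded[OF integrable_abs[OF int_X[OF j]], where c = \<delta>])
        (use \<delta> in auto)
    have "var j - trunc3 j / (4 * \<delta>)
        = expectation (\<lambda>\<omega>. (X j \<omega>)\<^sup>2 - (X j \<omega>)\<^sup>2 * min \<bar>X j \<omega>\<bar> 1 / (4 * \<delta>))"
      using int_X2[OF j] integrable_trunc[OF j] by simp
    also have "\<dots> \<le> expectation (\<lambda>\<omega>. \<bar>X j \<omega>\<bar> * min \<delta> \<bar>X j \<omega>\<bar>)"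
      using int int_X2[OF j] integrable_trunc[OF j] \<delta>
      by (intro integral_mono gain_lower_bound) auto
    finally show "var j - trunc3 j / (4 * \<delta>) \<le> expectation (\<lambda>\<omega>. \<bar>X j \<omega>\<bar> * min \<delta> \<bar>X j \<omega>\<bar>)" .
  qed
  finally show ?thesis .
qed

context
  fixes \<delta> :: real
  assumes var1: "(\<Sum>i\<in>I. var i) = 1" and \<delta>: "0 < \<delta>" "\<delta> \<le> 1 / 64"
    and \<beta>: "(\<Sum>i\<in>I. trunc3 i) \<le> \<delta>"
begin

text \<open>With m = min \<bar>x\<bar> 1, concentration contributes 4 (2 m + 4 \<delta>) and the
  smooth part 10 m (1 + 1). The clamp margin is the same \<open>\<delta>\<close> that bounds the
  truncated third moments.\<close>

lemma expectation_stein_modulus: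
  assumes i: "i \<in> I"
  shows "integrable M (\<lambda>\<omega>. stein_modulus z x (S (I - {i}) \<omega>))"
    and "expectation (\<lambda>\<omega>. stein_modulus z x (S (I - {i}) \<omega>)) \<le> 28 * min \<bar>x\<bar> 1 + 16 * \<delta>"
proof -
  let ?m = "min \<bar>x\<bar> 1" and ?J = "I - {i}"
  have J: "?J \<subseteq> I" by blast
  note [measurable] = measurable_S[OF J]
  have varJ: "(\<Sum>j\<in>?J. var j) \<le> 1"
    unfolding var1[symmetric] using finite_I by (intro sum_mono2) auto
  let ?A = "{\<omega> \<in> space M. \<bar>S ?J \<omega> - z\<bar> \<le> ?m}"
  have [measurable]: "?A \<in> sets M" by measurable
  have eq: "stein_modulus z x (S ?J \<omega>) = 4 * indicator ?A \<omega> + 10 * ?m * (1 + \<bar>S ?J \<omega>\<bar>)"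
    if "\<omega> \<in> space M" for \<omega>
    using that by (auto simp: stein_modulus_def)
  have int: "integrable M (\<lambda>\<omega>. 4 * indicator ?A \<omega> + 10 * ?m * (1 + \<bar>S ?J \<omega>\<bar>))"
    using integrable_S[OF J] by (auto simp: emeasure_eq_measure)
  then show "integrable M (\<lambda>\<omega>. stein_modulus z x (S ?J \<omega>))"
    by (subst Bochner_Integration.integrable_cong[OF refl eq]) auto
  have "expectation (\<lambda>\<omega>. stein_modulus z x (S ?J \<omega>))
      = expectation (\<lambda>\<omega>. 4 * indicator ?A \<omega> + 10 * ?m * (1 + \<bar>S ?J \<omega>\<bar>))"
    by (intro Bochner_Integration.integral_cong refl eq)
  also have "\<dots> = 4 * prob ?A + 10 * ?m * (1 + expectation (\<lambda>\<omega>. \<bar>S ?J \<omega>\<bar>))"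
    using integrable_S[OF J] by (simp add: emeasure_eq_measure prob_space)
  also have "\<dots> \<le> 4 * (2 * ?m + 4 * \<delta>) + 10 * ?m * (1 + 1)"
    using expectation_abs_S_le[OF J varJ]
      concentration[OF J varJ _ \<delta>(1) leave_one_out_gain[OF var1 \<delta> \<beta> i], of ?m z]
    by (intro add_mono mult_left_mono) auto
  finally show "expectation (\<lambda>\<omega>. stein_modulus z x (S ?J \<omega>)) \<le> 28 * ?m + 16 * \<delta>" by simp
qed

text \<open>In the mean, X f(W) vanishes and X^2 f'(W) factors. The difference thus splits into a
  Taylor remainder at W, weighted by X^2, and the cost of replacing f'(W) by f'(S), weighted by the
  variance.\<close>

lemma stein_summand:
  fixes z :: real
  assumes i: "i \<in> I"
  defines "f \<equiv> stein_sol z" and "g \<equiv> stein_sol_deriv z"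
  shows "\<bar>expectation (\<lambda>\<omega>. X i \<omega> * f (S I \<omega>)) - var i * expectation (\<lambda>\<omega>. g (S I \<omega>))\<bar>
    \<le> 56 * trunc3 i + 32 * \<delta> * var i"
proof -
  let ?W = "S (I - {i})" and ?D = "\<lambda>\<omega>. stein_modulus z (X i \<omega>) (S (I - {i}) \<omega>)"
  have J: "I - {i} \<subseteq> I" by blast
  note [measurable] = measurable_S[OF J] measurable_S[OF order_refl] measurable_X[OF i]
  have [measurable]: "f \<in> borel_measurable borel" "g \<in> borel_measurable borel"
    by (simp_all add: f_def g_def)
  have SI: "S I \<omega> = ?W \<omega> + X i \<omega>" for \<omega>
    using finite_I i by (simp add: sum.remove)
  have ind: "indep_var borel (X i) borel ?W" by (rule indep_var_leave_one_out[OF order_refl i])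
  have int_fW: "integrable M (\<lambda>\<omega>. f (?W \<omega>))"
    by (rule integrable_const_bound[of _ 8]) (simp_all add: f_def stein_sol_bound)
  have int_gW: "integrable M (\<lambda>\<omega>. g (?W \<omega>))" "integrable M (\<lambda>\<omega>. g (S I \<omega>))"
    by (rule integrable_const_bound[of _ 2], simp_all add: g_def stein_sol_deriv_bound)+
  have int_Xf: "integrable M (\<lambda>\<omega>. X i \<omega> * f (S I \<omega>))"
    by (rule integrable_mult_bounded[OF int_X[OF i], where c = 8])
      (simp_all add: f_def stein_sol_bound)
  have Xf: "integrable M (\<lambda>\<omega>. X i \<omega> * f (?W \<omega>))" "expectation (\<lambda>\<omega>. X i \<omega> * f (?W \<omega>)) = 0"
    using expectation_mult_leave_one_out[OF order_refl i, of "\<lambda>x. x" f] int_fW int_X[OF i] mean_X[OF i]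
    by auto
  have Xg: "integrable M (\<lambda>\<omega>. (X i \<omega>)\<^sup>2 * g (?W \<omega>))"
    "expectation (\<lambda>\<omega>. (X i \<omega>)\<^sup>2 * g (?W \<omega>)) = var i * expectation (\<lambda>\<omega>. g (?W \<omega>))"
    using expectation_mult_leave_one_out[OF order_refl i, of "\<lambda>x. x\<^sup>2" g] int_gW int_X2[OF i]
    by auto
  have D1: "integrable M ?D" "expectation ?D \<le> expectation (\<lambda>\<omega>. 28 * min \<bar>X i \<omega>\<bar> 1 + 16 * \<delta>)"
    using indep_var_integral_le[OF ind borel_measurable_stein_modulus stein_modulus_nonneg
      expectation_stein_modulus[OF i]] integrable_trunc[OF i] by auto
  have D2: "integrable M (\<lambda>\<omega>. (X i \<omega>)\<^sup>2 * ?D \<omega>)"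
    "expectation (\<lambda>\<omega>. (X i \<omega>)\<^sup>2 * ?D \<omega>)
      \<le> expectation (\<lambda>\<omega>. (X i \<omega>)\<^sup>2 * (28 * min \<bar>X i \<omega>\<bar> 1 + 16 * \<delta>))"
  proof -
    have int: "integrable M (\<lambda>\<omega>. (X i \<omega>)\<^sup>2 * (28 * min \<bar>X i \<omega>\<bar> 1 + 16 * \<delta>))"
    proof -
      have "integrable M (\<lambda>\<omega>. 28 * ((X i \<omega>)\<^sup>2 * min \<bar>X i \<omega>\<bar> 1) + 16 * \<delta> * (X i \<omega>)\<^sup>2)"
        using int_X2[OF i] integrable_trunc[OF i] by auto
      then show ?thesis by (simp add: algebra_simps)
    qed
    have "integrable M (\<lambda>\<omega>. x\<^sup>2 * stein_modulus z x (?W \<omega>))"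
      "expectation (\<lambda>\<omega>. x\<^sup>2 * stein_modulus z x (?W \<omega>)) \<le> x\<^sup>2 * (28 * min \<bar>x\<bar> 1 + 16 * \<delta>)" for x
      using expectation_stein_modulus[OF i, of z x] by (auto intro!: mult_left_mono)
    then show "integrable M (\<lambda>\<omega>. (X i \<omega>)\<^sup>2 * ?D \<omega>)"
      "expectation (\<lambda>\<omega>. (X i \<omega>)\<^sup>2 * ?D \<omega>)
        \<le> expectation (\<lambda>\<omega>. (X i \<omega>)\<^sup>2 * (28 * min \<bar>X i \<omega>\<bar> 1 + 16 * \<delta>))"
      using indep_var_integral_le[OF ind, of "\<lambda>x w. x\<^sup>2 * stein_modulus z x w"
          "\<lambda>x. x\<^sup>2 * (28 * min \<bar>x\<bar> 1 + 16 * \<delta>)"] int stein_modulus_nonneg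
      by auto
  qed
  let ?r = "\<lambda>\<omega>. X i \<omega> * f (S I \<omega>) - X i \<omega> * f (?W \<omega>) - (X i \<omega>)\<^sup>2 * g (?W \<omega>)"
  have "\<bar>expectation ?r\<bar> \<le> expectation (\<lambda>\<omega>. (X i \<omega>)\<^sup>2 * ?D \<omega>)"
  proof (rule order_trans[OF integral_abs_bound integral_mono])
    fix \<omega>
    have "?r \<omega> = X i \<omega> * (f (?W \<omega> + X i \<omega>) - f (?W \<omega>) - X i \<omega> * g (?W \<omega>))"
      unfolding SI by (simp add: power2_eq_square algebra_simps)
    also have "\<bar>\<dots>\<bar> \<le> \<bar>X i \<omega>\<bar> * (\<bar>X i \<omega>\<bar> * ?D \<omega>)"
      unfolding abs_mult f_def g_def by (intro mult_left_mono stein_sol_taylor) auto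
    finally show "\<bar>?r \<omega>\<bar> \<le> (X i \<omega>)\<^sup>2 * ?D \<omega>" by (simp add: power2_eq_square mult.assoc[symmetric])
  qed (use int_Xf Xf Xg D2 in auto)
  also note D2(2)
  also have "expectation (\<lambda>\<omega>. (X i \<omega>)\<^sup>2 * (28 * min \<bar>X i \<omega>\<bar> 1 + 16 * \<delta>))
      = 28 * trunc3 i + 16 * \<delta> * var i"
  proof -
    have "expectation (\<lambda>\<omega>. (X i \<omega>)\<^sup>2 * (28 * min \<bar>X i \<omega>\<bar> 1 + 16 * \<delta>))
        = expectation (\<lambda>\<omega>. 28 * ((X i \<omega>)\<^sup>2 * min \<bar>X i \<omega>\<bar> 1) + 16 * \<delta> * (X i \<omega>)\<^sup>2)"
      by (simp add: algebra_simps)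
    then show ?thesis using int_X2[OF i] integrable_trunc[OF i] by simp
  qed
  finally have r: "\<bar>expectation ?r\<bar> \<le> 28 * trunc3 i + 16 * \<delta> * var i" .
  have r_eq: "expectation ?r
      = expectation (\<lambda>\<omega>. X i \<omega> * f (S I \<omega>)) - var i * expectation (\<lambda>\<omega>. g (?W \<omega>))"
    using int_Xf Xf Xg by simp
  have "\<bar>expectation (\<lambda>\<omega>. g (S I \<omega>) - g (?W \<omega>))\<bar> \<le> expectation ?D"
  proof (rule order_trans[OF integral_abs_bound integral_mono])
    fix \<omega>
    show "\<bar>g (S I \<omega>) - g (?W \<omega>)\<bar> \<le> ?D \<omega>"
      unfolding SI g_def by (rule stein_sol_deriv_modulus)
  qed (use int_gW D1 in auto)
  also note D1(2)
  also have "expectation (\<lambda>\<omega>. 28 * min \<bar>X i \<omega>\<bar> 1 + 16 * \<delta>)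
      = 28 * expectation (\<lambda>\<omega>. min \<bar>X i \<omega>\<bar> 1) + 16 * \<delta>"
    using integrable_trunc[OF i] by (simp add: prob_space)
  finally have "var i * \<bar>expectation (\<lambda>\<omega>. g (S I \<omega>) - g (?W \<omega>))\<bar>
      \<le> var i * (28 * expectation (\<lambda>\<omega>. min \<bar>X i \<omega>\<bar> 1) + 16 * \<delta>)"
    by (intro mult_left_mono) auto
  \<comment> \<open>Unlike in the Taylor remainder, X^2 and min \<bar>X\<bar> 1 are averaged
    separately here; association merges them into one truncated third moment.\<close>
  also have "\<dots> \<le> 28 * trunc3 i + 16 * \<delta> * var i"
    using truncation_association[OF int_X2[OF i] measurable_X[OF i]] by (simp add: algebra_simps)
  finally have "\<bar>var i * (expectation (\<lambda>\<omega>. g (S I \<omega>)) - expectation (\<lambda>\<omega>. g (?W \<omega>)))\<bar>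
      \<le> 28 * trunc3 i + 16 * \<delta> * var i"
    using int_gW by (simp add: abs_mult)
  then show ?thesis
    using r[unfolded r_eq] by (simp add: right_diff_distrib)
qed

lemma normal_approximation:
  "\<bar>\<P>(\<omega> in M. S I \<omega> \<le> z) - normal_cdf z\<bar> \<le> 88 * \<delta>"
proof -
  let ?f = "stein_sol z" and ?g = "stein_sol_deriv z"
  note [measurable] = measurable_S[OF order_refl]
  have int_g: "integrable M (\<lambda>\<omega>. ?g (S I \<omega>))"
    using stein_sol_deriv_bound[of z] by (auto intro!: integrable_const_bound[of _ 2])
  have int_Xf: "integrable M (\<lambda>\<omega>. X i \<omega> * ?f (S I \<omega>))" if i: "i \<in> I" for i
    by (rule integrable_mult_bounded[OF int_X[OF i], where c = 8])
      (simp_all add: stein_sol_bound)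
  let ?A = "{\<omega> \<in> space M. S I \<omega> \<le> z}"
  have A: "?A \<in> sets M" by measurable
  have "prob ?A - normal_cdf z = expectation (\<lambda>\<omega>. indicator ?A \<omega> - normal_cdf z)"
    using A by (simp add: emeasure_eq_measure prob_space)
  also have "\<dots> = expectation (\<lambda>\<omega>. ?g (S I \<omega>) - (\<Sum>i\<in>I. X i \<omega> * ?f (S I \<omega>)))"
    unfolding sum_distrib_right[symmetric] stein_equation
    by (intro Bochner_Integration.integral_cong refl) (simp add: indicator_def)
  \<comment> \<open>The total variance 1 is inserted as a factor so that the derivative term can be
    distributed over the summands.\<close>
  also have "\<dots> = (\<Sum>i\<in>I. var i) * expectation (\<lambda>\<omega>. ?g (S I \<omega>))
      - (\<Sum>i\<in>I. expectation (\<lambda>\<omega>. X i \<omega> * ?f (S I \<omega>)))"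
    using int_g int_Xf by (simp add: var1)
  also have "\<dots> = - (\<Sum>i\<in>I. expectation (\<lambda>\<omega>. X i \<omega> * ?f (S I \<omega>)) - var i * expectation (\<lambda>\<omega>. ?g (S I \<omega>)))"
    by (simp add: sum_subtractf sum_distrib_right)
  finally have "\<bar>prob ?A - normal_cdf z\<bar>
      = \<bar>\<Sum>i\<in>I. expectation (\<lambda>\<omega>. X i \<omega> * ?f (S I \<omega>)) - var i * expectation (\<lambda>\<omega>. ?g (S I \<omega>))\<bar>"
    by simp
  also have "\<dots> \<le> (\<Sum>i\<in>I. 56 * trunc3 i + 32 * \<delta> * var i)"
    by (rule order_trans[OF sum_abs sum_mono]) (rule stein_summand)
  also have "\<dots> = 56 * (\<Sum>i\<in>I. trunc3 i) + 32 * \<delta>"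
    using var1 by (simp add: sum.distrib sum_distrib_left[symmetric])
  finally show ?thesis using \<beta> by simp
qed

end

end

subsection \<open>Triangular arrays\<close>

lemma distributed_std_normal_prob_le:
  assumes "prob_space M" "distributed M lborel \<xi>0 std_normal_density"
  shows "measure M {\<omega> \<in> space M. \<xi>0 \<omega> \<le> x} = normal_cdf x"
proof -
  have [measurable]: "\<xi>0 \<in> borel_measurable M"
    using distributed_measurable[OF assms(2)] by simp
  have "normal_cdf x = measure (distr M lborel \<xi>0) {..x}"
    unfolding cdf_def distributed_distr_eq_density[OF assms(2)] ..
  also have "\<dots> = measure M (\<xi>0 -` {..x} \<inter> space M)"
    by (rule measure_distr) auto
  also have "\<xi>0 -` {..x} \<inter> space M = {\<omega> \<in> space M. \<xi>0 \<omega> \<le> x}" by auto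
  finally show ?thesis by simp
qed

lemma Kolmogorov_dist_le:
  assumes M: "prob_space M" and \<xi>0: "distributed M lborel \<xi>0 std_normal_density"
    and arr: "standard_triangular_array M \<xi>" and n: "1 \<le> n" and \<epsilon>: "0 < \<epsilon>" "\<epsilon> \<le> 1"
  shows "Kolmogorov_dist M \<xi>0 (\<lambda>\<omega>. \<Sum>k=1..n. \<xi> n k \<omega>) \<le> ereal (88 * (\<epsilon> +
    (\<Sum>k=1..n. LINT \<omega>:{\<omega> \<in> space M. \<bar>\<xi> n k \<omega>\<bar> > \<epsilon>}|M. (\<xi> n k \<omega>)\<^sup>2)))"
proof -
  let ?A = "\<lambda>k. {\<omega> \<in> space M. \<bar>\<xi> n k \<omega>\<bar> > \<epsilon>}"
  let ?L = "\<lambda>k. LINT \<omega>:?A k|M. (\<xi> n k \<omega>)\<^sup>2"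
  interpret centered_indep_family M "\<xi> n" "{1..n}"
    using M arr n
    by (simp add: standard_triangular_array_def centered_indep_family_def
        centered_indep_family_axioms_def)
  have var1: "(\<Sum>k=1..n. var k) = 1"
    using arr n by (auto simp: standard_triangular_array_def)
  \<comment> \<open>The summand \<open>\<epsilon>\<close> also keeps \<open>\<delta>\<close>
    positive when the Lindeberg sum is 0.\<close>
  define \<delta> where "\<delta> = \<epsilon> + (\<Sum>k=1..n. ?L k)"
  have L0: "0 \<le> ?L k" for k
    unfolding set_lebesgue_integral_def by (intro Bochner_Integration.integral_nonneg) auto
  then have "0 \<le> (\<Sum>k=1..n. ?L k)" by (intro sum_nonneg)
  then have \<delta>: "0 < \<delta>" using \<epsilon> by (simp add: \<delta>_def)
  have \<beta>: "(\<Sum>k=1..n. trunc3 k) \<le> \<delta>"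
  proof -
    have "(\<Sum>k=1..n. trunc3 k) \<le> (\<Sum>k=1..n. \<epsilon> * var k + ?L k)"
    proof (rule sum_mono)
      fix k assume k: "k \<in> {1..n}"
      note [measurable] = measurable_X[OF k]
      have int: "integrable M (\<lambda>\<omega>. indicator (?A k) \<omega> * (\<xi> n k \<omega>)\<^sup>2)"
      proof -
        have "?A k \<in> sets M" by measurable
        from integrable_real_mult_indicator[OF this int_X2[OF k]] show ?thesis
          by (simp only: mult.commute)
      qed
      have "trunc3 k \<le> expectation (\<lambda>\<omega>. \<epsilon> * (\<xi> n k \<omega>)\<^sup>2 + indicator (?A k) \<omega> * (\<xi> n k \<omega>)\<^sup>2)"
      proof (rule integral_mono)
        fix \<omega> assume "\<omega> \<in> space M"
        show "(\<xi> n k \<omega>)\<^sup>2 * min \<bar>\<xi> n k \<omega>\<bar> 1 \<le> \<epsilon> * (\<xi> n k \<omega>)\<^sup>2 + indicator (?A k) \<omega> * (\<xi> n k \<omega>)\<^sup>2"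
        proof (cases "\<bar>\<xi> n k \<omega>\<bar> > \<epsilon>")
          case True
          have "(\<xi> n k \<omega>)\<^sup>2 * min \<bar>\<xi> n k \<omega>\<bar> 1 \<le> (\<xi> n k \<omega>)\<^sup>2 * 1" by (intro mult_left_mono) auto
          also have "\<dots> \<le> \<epsilon> * (\<xi> n k \<omega>)\<^sup>2 + (\<xi> n k \<omega>)\<^sup>2" using \<epsilon> by simp
          finally show ?thesis using True \<open>\<omega> \<in> space M\<close> by simp
        next
          case False
          then have "(\<xi> n k \<omega>)\<^sup>2 * min \<bar>\<xi> n k \<omega>\<bar> 1 \<le> (\<xi> n k \<omega>)\<^sup>2 * \<epsilon>" by (intro mult_left_mono) auto
          then show ?thesis using False by (simp add: mult.commute)
        qed
      qed (use int int_X2[OF k] integrable_trunc[OF k] in auto)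
      also have "\<dots> = \<epsilon> * var k + ?L k"
        using int int_X2[OF k] by (simp add: set_lebesgue_integral_def)
      finally show "trunc3 k \<le> \<epsilon> * var k + ?L k" .
    qed
    also have "\<dots> = \<delta>"
      using var1 by (simp add: \<delta>_def sum.distrib sum_distrib_left[symmetric])
    finally show ?thesis .
  qed
  have "\<bar>prob {\<omega> \<in> space M. \<xi>0 \<omega> \<le> x} - prob {\<omega> \<in> space M. (\<Sum>k=1..n. \<xi> n k \<omega>) \<le> x}\<bar> \<le> 88 * \<delta>" for x
  proof (cases "\<delta> \<le> 1 / 64")
    case True
    then show ?thesis
      using normal_approximation[OF var1 \<delta> True \<beta>, of x] distributed_std_normal_prob_le[OF M \<xi>0, of x]
      by (simp add: abs_minus_commute)
  next
    \<comment> \<open>Since 88/64 > 1, the bound exceeds any difference of probabilities.\<close>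
    case False
    have "\<bar>prob A - prob B\<bar> \<le> 1" for A B
      using prob_le_1[of A] prob_le_1[of B] measure_nonneg[of M A] measure_nonneg[of M B] by linarith
    moreover have "1 \<le> 88 * \<delta>" using False by simp
    ultimately show ?thesis by (rule order_trans)
  qed
  then show ?thesis
    unfolding Kolmogorov_dist_def \<delta>_def by (intro SUP_least) simp
qed

lemma limsup_Kolmogorov_dist_le:
  assumes M: "prob_space M" and \<xi>0: "distributed M lborel \<xi>0 std_normal_density"
    and arr: "standard_triangular_array M \<xi>"
  shows "limsup (\<lambda>n. Kolmogorov_dist M \<xi>0 (\<lambda>\<omega>. \<Sum>k=1..n. \<xi> n k \<omega>)) \<le> ereal 88 * Lindeberg_index M \<xi>"
proof -
  define L where "L = (\<lambda>\<epsilon> n. \<Sum>k=1..n. LINT \<omega>:{\<omega> \<in> space M. \<bar>\<xi> n k \<omega>\<bar> > \<epsilon>}|M. (\<xi> n k \<omega>)\<^sup>2)"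
  let ?K = "limsup (\<lambda>n. Kolmogorov_dist M \<xi>0 (\<lambda>\<omega>. \<Sum>k=1..n. \<xi> n k \<omega>))"
  have Lin: "Lindeberg_index M \<xi> = (SUP \<epsilon>\<in>{0<..}. limsup (\<lambda>n. ereal (L \<epsilon> n)))"
    by (simp add: Lindeberg_index_def L_def)
  have "0 \<le> L \<epsilon> n" for \<epsilon> n
    unfolding L_def set_lebesgue_integral_def
    by (intro sum_nonneg Bochner_Integration.integral_nonneg) auto
  then have "0 \<le> limsup (\<lambda>n. ereal (L 1 n))"
    by (intro le_Limsup) auto
  then have "0 \<le> Lindeberg_index M \<xi>"
    unfolding Lin by (intro SUP_upper2[of 1]) auto
  \<comment> \<open>Nonnegativity excludes minus infinity, and for an infinite index the right side
    is infinite.\<close>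
  then consider "Lindeberg_index M \<xi> = \<infinity>" | l where "Lindeberg_index M \<xi> = ereal l"
    by (cases "Lindeberg_index M \<xi>") auto
  then show ?thesis
  proof cases
    case 1
    then show ?thesis by simp
  next
    case (2 l)
    \<comment> \<open>The same \<open>\<epsilon>\<close> is the Lindeberg threshold and the slack
      above the upper limit. Its total weight is 2 * 88 = 176, which explains the later choice of e
      / 176.\<close>
    have bound: "?K \<le> ereal (88 * (\<epsilon> + (l + \<epsilon>)))" if \<epsilon>: "0 < \<epsilon>" "\<epsilon> \<le> 1" for \<epsilon> :: real
    proof (rule Limsup_bounded)
      have "limsup (\<lambda>n. ereal (L \<epsilon> n)) \<le> ereal l"
        unfolding 2[symmetric] Lin using \<epsilon> by (intro SUP_upper) auto
      also have "\<dots> < ereal (l + \<epsilon>)" using \<epsilon> by simp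
      finally have "\<forall>\<^sub>F n in sequentially. ereal (L \<epsilon> n) < ereal (l + \<epsilon>)" by (rule Limsup_lessD)
      then show "\<forall>\<^sub>F n in sequentially.
          Kolmogorov_dist M \<xi>0 (\<lambda>\<omega>. \<Sum>k=1..n. \<xi> n k \<omega>) \<le> ereal (88 * (\<epsilon> + (l + \<epsilon>)))"
        \<comment> \<open>Row 0 carries no assumption, so it is excluded.\<close>
        using eventually_ge_at_top[of 1]
      proof eventually_elim
        case (elim n)
        have "Kolmogorov_dist M \<xi>0 (\<lambda>\<omega>. \<Sum>k=1..n. \<xi> n k \<omega>) \<le> ereal (88 * (\<epsilon> + L \<epsilon> n))"
          unfolding L_def by (rule Kolmogorov_dist_le[OF M \<xi>0 arr elim(2) \<epsilon>])
        also have "\<dots> \<le> ereal (88 * (\<epsilon> + (l + \<epsilon>)))" using elim(1) by simp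
        finally show ?case .
      qed
    qed
    show ?thesis
    proof (rule ereal_le_epsilon2)
      fix e :: real assume "0 < e"
      define \<epsilon> where "\<epsilon> = min 1 (e / 176)"
      have "0 < \<epsilon>" "\<epsilon> \<le> 1" "176 * \<epsilon> \<le> e" using \<open>0 < e\<close> by (auto simp: \<epsilon>_def)
      have "?K \<le> ereal (88 * (\<epsilon> + (l + \<epsilon>)))" by (rule bound) fact+
      also have "\<dots> \<le> ereal (88 * l + e)" using \<open>176 * \<epsilon> \<le> e\<close> by simp
      finally show "?K \<le> ereal 88 * Lindeberg_index M \<xi> + ereal e" using 2 by simp
    qed
  qed
qed

theorem theorem1p4:
  shows "\<exists>C::real. C > 0 \<and>
    (\<forall>(M :: 'a measure) (\<xi>0 :: 'a \<Rightarrow> real) (\<xi> :: nat \<Rightarrow> nat \<Rightarrow> 'a \<Rightarrow> real).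
       prob_space M \<longrightarrow>
       distributed M lborel \<xi>0 std_normal_density \<longrightarrow>
       standard_triangular_array M \<xi> \<longrightarrow>
       limsup (\<lambda>n. Kolmogorov_dist M \<xi>0 (\<lambda>\<omega>. \<Sum>k=1..n. \<xi> n k \<omega>))
         \<le> ereal C * Lindeberg_index M \<xi>)"
  by (intro exI[of _ 88] conjI allI impI limsup_Kolmogorov_dist_le) auto

end
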